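(* Fix $k\in\{1,\dots,n\}$ and fixed prices $r_1,\dots,r_n\ge 0$ of the traditional products, ordered so that $r_1\ge r_2\ge\cdots\ge r_n$. Then the problem $$\max_{S\subseteq\mathcal N}\ \max_{T\subseteq S}\ \max_{\rho\ge 0}\ \mathrm{Rev}\big(\mathrm{Opq}_{(k)}(T,S,\bm r_S,\rho)\big)$$ admits an optimal assortment $S^*$ of the form $S^*=\{1,\dots,j\}$ for some $j\in\{1,2,\dots,n\}$.
   Context: Setting. $\mathcal N=\{1,\dots,n\}$ is a set of products with fixed intrinsic valuations $v_i\in\mathbb R$. Customer valuations are $V_i=v_i+\epsilon_i$ for $i\in\mathcal N$ and $V_0=\epsilon_0$ for the no-purchase option $0$, with $\epsilon_0,\dots,\epsilon_n$ i.i.d. standard Gumbel$(0,1)$. For $S\subseteq\mathcal N$, $\bm r_S=(r_i)_{i\in S}$; utilities are $U_i=V_i-r_i$ and $U_0=V_0$. Opaque-MNL model $\mathrm{Opq}_{(k)}(T,S,\bm r_S,\rho)$: the products of $S$ are offered at prices $\bm r_S$ together with an opaque product $q$ at price $\rho$ with opaque support $T\subseteq S$. The customer's valuation of $q$ is $V_{(k)}^T$, the $k$-th smallest value among $\{V_j:j\in T\}$, with the convention $V_{(k)}^T=\max_{j\in T}V_j$ if $k>|T|$ (if $T=\emptyset$ this is $-\infty$, i.e. $q$ is never purchased). The utility of $q$ is $U_q=V_{(k)}^T-\rho$. The customer chooses the option of highest utility in $S\cup\{0,q\}$, ties between $q$ and another option being broken in favor of $q$. With $\pi(\cdot)$ the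 resulting choice probabilities, $\mathrm{Rev}(\mathrm{Opq}_{(k)}(T,S,\bm r_S,\rho))=\sum_{i\in S}r_i\,\pi(i)+\rho\,\pi(q)$. An assortment $S^*$ is optimal if $\max_{T\subseteq S}\max_{\rho\ge0}\mathrm{Rev}(\mathrm{Opq}_{(k)}(T,S,\bm r_S,\rho))$ is maximized over $S\subseteq\mathcal N$ at $S=S^*$. *)

theory Defs
  imports "HOL-Probability.Probability"
begin

definition std_gumbel_density :: "real \<Rightarrow> real" where
  "std_gumbel_density x = exp (- (x + exp (- x)))"

text \<open>
  Options are natural numbers: 0 is the no-purchase option and 1, ..., n are the products.
  The argument \<open>e\<close> is one realisation of the noise terms; randomness enters only
  in the choice probabilities below.
\<close>

definition valuation :: "(nat \<Rightarrow> real) \<Rightarrow> (nat \<Rightarrow> real) \<Rightarrow> nat \<Rightarrow> real" where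
  "valuation v e i = (if i = 0 then e 0 else v i + e i)"

definition utility ::
  "(nat \<Rightarrow> real) \<Rightarrow> (nat \<Rightarrow> real) \<Rightarrow> (nat \<Rightarrow> real) \<Rightarrow> nat \<Rightarrow> real" where
  "utility v r e i = valuation v e i - (if i = 0 then 0 else r i)"

text \<open>The k-th smallest (k counted from 1) of the valuations over \<open>T\<close>.\<close>

definition opaque_valuation ::
  "nat \<Rightarrow> (nat \<Rightarrow> real) \<Rightarrow> nat set \<Rightarrow> (nat \<Rightarrow> real) \<Rightarrow> ereal" where
  "opaque_valuation k v T e =
     (if T = {} then - \<infinity>
      else if k > card T then ereal (Max (valuation v e ` T))
      else ereal (sort (map (valuation v e) (sorted_list_of_set T)) ! (k - 1)))"

definition opaque_utility ::
  "nat \<Rightarrow> (nat \<Rightarrow> real) \<Rightarrow> nat set \<Rightarrow> real \<Rightarrow> (nat \<Rightarrow> real) \<Rightarrow> ereal" where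
  "opaque_utility k v T \<rho> e = opaque_valuation k v T e - ereal \<rho>"

text \<open>
  Ties with the opaque product go to the opaque product. Ties among the options in
  \<open>S \<union> {0}\<close> are left unresolved: for Gumbel noise they form a null event.
\<close>

definition chooses_opaque ::
  "nat \<Rightarrow> (nat \<Rightarrow> real) \<Rightarrow> (nat \<Rightarrow> real) \<Rightarrow> nat set \<Rightarrow> nat set \<Rightarrow> real
    \<Rightarrow> (nat \<Rightarrow> real) \<Rightarrow> bool" where
  "chooses_opaque k v r T S \<rho> e \<longleftrightarrow>
     (\<forall>j\<in>insert 0 S. ereal (utility v r e j) \<le> opaque_utility k v T \<rho> e)"

definition chooses ::
  "nat \<Rightarrow> (nat \<Rightarrow> real) \<Rightarrow> (nat \<Rightarrow> real) \<Rightarrow> nat set \<Rightarrow> nat set \<Rightarrow> real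
    \<Rightarrow> (nat \<Rightarrow> real) \<Rightarrow> nat \<Rightarrow> bool" where
  "chooses k v r T S \<rho> e i \<longleftrightarrow>
     i \<in> insert 0 S \<and>
     (\<forall>j\<in>insert 0 S. utility v r e j \<le> utility v r e i) \<and>
     opaque_utility k v T \<rho> e < ereal (utility v r e i)"

definition choice_prob ::
  "'a measure \<Rightarrow> (nat \<Rightarrow> 'a \<Rightarrow> real) \<Rightarrow> nat \<Rightarrow> (nat \<Rightarrow> real) \<Rightarrow> (nat \<Rightarrow> real)
    \<Rightarrow> nat set \<Rightarrow> nat set \<Rightarrow> real \<Rightarrow> nat \<Rightarrow> real" where
  "choice_prob M \<epsilon> k v r T S \<rho> i =
     measure M {\<omega> \<in> space M. chooses k v r T S \<rho> (\<lambda>l. \<epsilon> l \<omega>) i}"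

definition opaque_choice_prob ::
  "'a measure \<Rightarrow> (nat \<Rightarrow> 'a \<Rightarrow> real) \<Rightarrow> nat \<Rightarrow> (nat \<Rightarrow> real) \<Rightarrow> (nat \<Rightarrow> real)
    \<Rightarrow> nat set \<Rightarrow> nat set \<Rightarrow> real \<Rightarrow> real" where
  "opaque_choice_prob M \<epsilon> k v r T S \<rho> =
     measure M {\<omega> \<in> space M. chooses_opaque k v r T S \<rho> (\<lambda>l. \<epsilon> l \<omega>)}"

definition Rev ::
  "'a measure \<Rightarrow> (nat \<Rightarrow> 'a \<Rightarrow> real) \<Rightarrow> nat \<Rightarrow> (nat \<Rightarrow> real) \<Rightarrow> (nat \<Rightarrow> real)
    \<Rightarrow> nat set \<Rightarrow> nat set \<Rightarrow> real \<Rightarrow> real" where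
  "Rev M \<epsilon> k v r T S \<rho> =
     (\<Sum>i\<in>S. r i * choice_prob M \<epsilon> k v r T S \<rho> i) + \<rho> * opaque_choice_prob M \<epsilon> k v r T S \<rho>"

definition is_max_value :: "('b \<Rightarrow> real) \<Rightarrow> 'b set \<Rightarrow> real \<Rightarrow> bool" where
  "is_max_value f A m \<longleftrightarrow> (\<exists>x\<in>A. f x = m) \<and> (\<forall>x\<in>A. f x \<le> m)"

text \<open>
  Each nested maximum is required to be attained, so \<open>P S T\<close> (the maximum over prices)
  and \<open>Q S\<close> (the maximum over supports and prices) are uniquely determined on the
  relevant arguments.
\<close>

definition optimal_assortment ::
  "'a measure \<Rightarrow> (nat \<Rightarrow> 'a \<Rightarrow> real) \<Rightarrow> nat \<Rightarrow> nat \<Rightarrow> (nat \<Rightarrow> real) \<Rightarrow> (nat \<Rightarrow> real)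
    \<Rightarrow> nat set \<Rightarrow> bool" where
  "optimal_assortment M \<epsilon> n k v r S' \<longleftrightarrow>
     S' \<subseteq> {1..n} \<and>
     (\<exists>P Q.
        (\<forall>S\<subseteq>{1..n}. \<forall>T\<subseteq>S. is_max_value (\<lambda>\<rho>. Rev M \<epsilon> k v r T S \<rho>) {0..} (P S T)) \<and>
        (\<forall>S\<subseteq>{1..n}. is_max_value (P S) (Pow S) (Q S)) \<and>
        is_max_value Q (Pow {1..n}) (Q S'))"

end

theory Submission imports Defs begin

text \<open>
  Whichever option wins with utility \<open>x\<close>, let \<open>K\<close> be the set of products of \<open>T\<close> that would beat
  \<open>x\<close> if sold at the opaque price, although at full price they do not. Under Gumbel noise the
  density of \<open>i\<close> winning at level \<open>x\<close> is proportional to the product of the distribution functions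
  with a factor \<open>exp (shift of i)\<close> times \<open>exp (- x)\<close>, so conditionally on \<open>K\<close> the model behaves
  like a plain MNL model: with \<open>m\<close> the rank from the top that defines the opaque product, all
  products have full price if \<open>card K < m - 1\<close>, while the products of \<open>T - K\<close> have price
  \<open>min (r i) \<rho>\<close> if \<open>card K = m - 1\<close>. The opaque revenue is thus a mixture of MNL revenues in which
  at most \<open>k\<close> products are discounted, and each of these is itself an opaque revenue, namely for a
  support of at most \<open>k\<close> products, where the opaque product is worth the maximum. So the optimal
  value \<open>R\<close> is attained by an MNL model with at most \<open>k\<close> discounted products, and there
  \<open>{i. R \<le> r i}\<close> is an optimal assortment by the usual exchange argument.

  The maximum over \<open>\<rho>\<close> is attained because the revenue is continuous in \<open>\<rho>\<close> and constant once
  \<open>\<rho>\<close> exceeds all prices.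
\<close>

section \<open>Choices as order statistics\<close>

text \<open>The opaque valuation is the value of rank \<open>rank_from_top k T\<close> counted from the top;
  this covers the convention \<open>k > card T\<close> as well.\<close>

definition rank_from_top :: "nat \<Rightarrow> nat set \<Rightarrow> nat" where
  "rank_from_top k T = (if card T < k then 1 else card T - k + 1)"

lemma rank_from_top_pos: "0 < rank_from_top k T"
  by (simp add: rank_from_top_def)

text \<open>In a sorted list the entries below \<open>x\<close> form an initial segment, so their
  number is the first index at which the entry is no longer below \<open>x\<close>.\<close>

lemma le_nth_sorted_iff:
  fixes xs :: "'b::linorder list"
  assumes "sorted xs" "i < length xs"
  shows "x \<le> xs ! i \<longleftrightarrow> length (filter (\<lambda>y. y < x) xs) \<le> i"
proof -
  have *: "filter (\<lambda>y. y < x) xs = takeWhile (\<lambda>y. y < x) xs"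
    using assms(1)
  proof (induction xs)
    case (Cons a xs)
    show ?case
    proof (cases "a < x")
      case False
      then have "\<not> y < x" if "y \<in> set xs" for y using Cons.prems that by fastforce
      then show ?thesis using False by (simp add: filter_empty_conv)
    qed (use Cons in simp)
  qed simp
  show ?thesis
  proof
    assume le: "x \<le> xs ! i"
    show "length (filter (\<lambda>y. y < x) xs) \<le> i"
    proof (rule ccontr)
      assume "\<not> ?thesis"
      then have "xs ! i < x"
        unfolding * by (metis not_le nth_mem set_takeWhileD takeWhile_nth)
      with le show False by simp
    qed
  next
    assume le: "length (filter (\<lambda>y. y < x) xs) \<le> i"
    let ?l = "length (takeWhile (\<lambda>y. y < x) xs)"
    have "?l \<le> i" using le * by simp
    then have "\<not> xs ! ?l < x" using assms(2) nth_length_takeWhile[of "\<lambda>y. y < x" xs] by simp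
    moreover have "xs ! ?l \<le> xs ! i" using assms \<open>?l \<le> i\<close> by (simp add: sorted_nth_mono)
    ultimately show "x \<le> xs ! i" by simp
  qed
qed

text \<open>Counting from the top makes the three cases of \<open>opaque_valuation\<close> uniform.
  For empty \<open>T\<close> the required rank is 1 while the count is 0, which matches the value
  minus infinity.\<close>

lemma le_opaque_utility_iff:
  assumes "finite T" "1 \<le> k"
  shows "ereal x \<le> opaque_utility k v T \<rho> e
    \<longleftrightarrow> rank_from_top k T \<le> card {j\<in>T. x \<le> valuation v e j - \<rho>}"
proof -
  let ?V = "valuation v e" and ?J = "{j\<in>T. x \<le> valuation v e j - \<rho>}"
  have fJ: "finite ?J" using assms by simp
  consider "T = {}" | "T \<noteq> {}" "card T < k" | "T \<noteq> {}" "k \<le> card T" by linarith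
  then show ?thesis
  proof cases
    case 1
    then show ?thesis by (simp add: opaque_utility_def opaque_valuation_def rank_from_top_def)
  next
    case 2
    have "ereal x \<le> opaque_utility k v T \<rho> e \<longleftrightarrow> x + \<rho> \<le> Max (?V ` T)"
      using 2 by (simp add: opaque_utility_def opaque_valuation_def le_diff_eq)
    also have "\<dots> \<longleftrightarrow> (\<exists>j\<in>T. x + \<rho> \<le> ?V j)"
      using 2 assms by (simp add: Max_ge_iff)
    also have "\<dots> \<longleftrightarrow> ?J \<noteq> {}"
      by (auto simp: le_diff_eq)
    also have "\<dots> \<longleftrightarrow> 1 \<le> card ?J"
      using card_gt_0_iff[of ?J] fJ by (simp add: Suc_le_eq del: card_gt_0_iff)
    finally show ?thesis using 2 by (simp add: rank_from_top_def)
  next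
    case 3
    let ?xs = "map ?V (sorted_list_of_set T)"
    have "ereal x \<le> opaque_utility k v T \<rho> e \<longleftrightarrow> x + \<rho> \<le> sort ?xs ! (k - 1)"
      using 3 by (simp add: opaque_utility_def opaque_valuation_def le_diff_eq)
    also have "\<dots> \<longleftrightarrow> length (filter (\<lambda>y. y < x + \<rho>) (sort ?xs)) \<le> k - 1"
      using 3 assms by (intro le_nth_sorted_iff) auto
    also have "length (filter (\<lambda>y. y < x + \<rho>) (sort ?xs))
        = length (filter (\<lambda>j. ?V j < x + \<rho>) (sorted_list_of_set T))"
    proof -
      have "mset (filter (\<lambda>y. y < x + \<rho>) (sort ?xs)) = mset (filter (\<lambda>y. y < x + \<rho>) ?xs)" by simp
      then have "length (filter (\<lambda>y. y < x + \<rho>) (sort ?xs)) = length (filter (\<lambda>y. y < x + \<rho>) ?xs)"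
        by (rule mset_eq_length)
      then show ?thesis by (simp only: filter_map length_map o_def)
    qed
    also have "\<dots> = card {j\<in>T. ?V j < x + \<rho>}"
      using distinct_card[of "filter (\<lambda>j. ?V j < x + \<rho>) (sorted_list_of_set T)"] assms(1)
      by (simp only: distinct_filter distinct_sorted_list_of_set set_filter set_sorted_list_of_set simp_thms)
    also have "{j\<in>T. ?V j < x + \<rho>} = T - ?J" by auto
    also have "card (T - ?J) = card T - card ?J"
      using fJ by (rule card_Diff_subset) auto
    also have "card T - card ?J \<le> k - 1 \<longleftrightarrow> card T - k + 1 \<le> card ?J"
      using assms(2) 3(2) by linarith
    finally show ?thesis using 3 by (simp add: rank_from_top_def)
  qed
qed

lemma chooses_iff:
  assumes "finite T" "1 \<le> k"
  shows "chooses k v r T S \<rho> e i \<longleftrightarrow> i \<in> insert 0 S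
    \<and> (\<forall>j\<in>insert 0 S. utility v r e j \<le> utility v r e i)
    \<and> card {j\<in>T. utility v r e i \<le> valuation v e j - \<rho>} < rank_from_top k T"
  using le_opaque_utility_iff[OF assms, of "utility v r e i" v \<rho> e]
  unfolding chooses_def by (metis not_le)

lemma chooses_opaque_iff:
  assumes "finite T" "1 \<le> k"
  shows "chooses_opaque k v r T S \<rho> e \<longleftrightarrow>
    (\<forall>i\<in>insert 0 S. rank_from_top k T \<le> card {j\<in>T. utility v r e i \<le> valuation v e j - \<rho>})"
  using le_opaque_utility_iff[OF assms] by (auto simp: chooses_opaque_def)

section \<open>Configurations around the winning level\<close>

text \<open>For \<open>i \<in> T\<close> this is the better of buying \<open>i\<close> itself and getting \<open>i\<close> at the opaque price.\<close>

definition discounted :: "(nat \<Rightarrow> real) \<Rightarrow> (nat \<Rightarrow> real) \<Rightarrow> (nat \<Rightarrow> real) \<Rightarrow> real \<Rightarrow> nat \<Rightarrow> real" where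
  "discounted v r e \<rho> i = valuation v e i - min (r i) \<rho>"

text \<open>The winner \<open>i\<close> has utility \<open>x\<close>, and apart from \<open>i\<close> the products of \<open>T\<close> that would
  beat it at the opaque price are exactly those in \<open>K\<close>.\<close>

definition configuration :: "(nat \<Rightarrow> real) \<Rightarrow> (nat \<Rightarrow> real) \<Rightarrow> nat set \<Rightarrow> nat set \<Rightarrow> real
    \<Rightarrow> (nat \<Rightarrow> real) \<Rightarrow> real \<Rightarrow> nat \<Rightarrow> nat set \<Rightarrow> bool" where
  "configuration v r T S \<rho> e x i K \<longleftrightarrow>
     (\<forall>j\<in>insert 0 S - {i}.
        if j \<in> K then utility v r e j < x \<and> x < discounted v r e \<rho> j
        else if j \<in> T then discounted v r e \<rho> j < x
        else utility v r e j < x)"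

definition no_ties :: "(nat \<Rightarrow> real) \<Rightarrow> (nat \<Rightarrow> real) \<Rightarrow> nat set \<Rightarrow> nat set \<Rightarrow> real
    \<Rightarrow> (nat \<Rightarrow> real) \<Rightarrow> bool" where
  "no_ties v r T S \<rho> e \<longleftrightarrow>
     (\<forall>i\<in>insert 0 S. \<forall>j\<in>insert 0 S. i \<noteq> j \<longrightarrow> utility v r e i \<noteq> utility v r e j \<and>
        (i \<in> T \<longrightarrow> valuation v e i - \<rho> \<noteq> utility v r e j \<and>
           (j \<in> T \<longrightarrow> valuation v e i \<noteq> valuation v e j)))"

lemma discounted_eq_max:
  "i \<noteq> 0 \<Longrightarrow> discounted v r e \<rho> i = max (utility v r e i) (valuation v e i - \<rho>)"
  by (auto simp: discounted_def utility_def)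

text \<open>For \<open>j\<close> in \<open>T - {i}\<close>, membership in \<open>K\<close> forces
  \<open>discounted\<close> strictly above \<open>x\<close> and non-membership forces it strictly
  below, so \<open>K\<close> can be read off. This makes the events of different configurations
  disjoint.\<close>

lemma configuration_unique:
  assumes "T \<subseteq> S" "K \<subseteq> T - {i}" "configuration v r T S \<rho> e x i K"
  shows "K = {j\<in>T - {i}. x < discounted v r e \<rho> j}"
proof -
  have "x < discounted v r e \<rho> j \<longleftrightarrow> j \<in> K" if "j \<in> T - {i}" for j
  proof -
    have "j \<in> insert 0 S - {i}" using that assms(1) by blast
    then have "if j \<in> K then utility v r e j < x \<and> x < discounted v r e \<rho> j
        else if j \<in> T then discounted v r e \<rho> j < x else utility v r e j < x"
      using assms(3) unfolding configuration_def by blast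
    then show ?thesis using that by (auto split: if_splits)
  qed
  then show ?thesis using assms(2) by blast
qed

text \<open>The witness \<open>K\<close> consists of the other products of \<open>T\<close> that
  would beat \<open>i\<close> if sold at the opaque price. The \<open>of_bool\<close> term counts
  \<open>i\<close> itself, which reaches its own utility at the opaque price exactly if
  \<open>\<rho> \<le> r i\<close>.\<close>

lemma chooses_iff_configuration:
  assumes T: "finite T" "1 \<le> k" "T \<subseteq> S" "0 \<notin> S" and nt: "no_ties v r T S \<rho> e" and i: "i \<in> insert 0 S"
  shows "chooses k v r T S \<rho> e i \<longleftrightarrow>
    (\<exists>K\<subseteq>T - {i}. card K + of_bool (i \<in> T \<and> \<rho> \<le> r i) < rank_from_top k T
      \<and> configuration v r T S \<rho> e (utility v r e i) i K)"
proof -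
  let ?u = "utility v r e" and ?y = "discounted v r e \<rho>"
  let ?z = "\<lambda>j. valuation v e j - \<rho>"
  define L where "L = {j\<in>T. ?u i \<le> ?z j}"
  have Li: "i \<in> L \<longleftrightarrow> i \<in> T \<and> \<rho> \<le> r i"
    using T by (auto simp: L_def utility_def)
  have "finite L" using T by (simp add: L_def)
  then have cL: "card L = card (L - {i}) + of_bool (i \<in> T \<and> \<rho> \<le> r i)"
    using Li card_Suc_Diff1[of L i] by (cases "i \<in> L") auto
  have zj: "?u i \<le> ?z j \<longleftrightarrow> ?u i < ?z j" if "j \<in> T - {i}" for j
    using nt that T i unfolding no_ties_def by (metis DiffE insertCI less_le subsetD)
  show ?thesis
  proof
    assume "chooses k v r T S \<rho> e i"
    then have ch: "\<forall>j\<in>insert 0 S. ?u j \<le> ?u i" and cd: "card L < rank_from_top k T"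
      using chooses_iff[OF T(1,2)] by (auto simp: L_def)
    have lt: "?u j < ?u i" if "j \<in> insert 0 S - {i}" for j
      using that ch nt i unfolding no_ties_def by (metis DiffE insertCI less_le)
    have "configuration v r T S \<rho> e (?u i) i (L - {i})"
      unfolding configuration_def
    proof (intro ballI)
      fix j assume j: "j \<in> insert 0 S - {i}"
      show "if j \<in> L - {i} then ?u j < ?u i \<and> ?u i < ?y j
          else if j \<in> T then ?y j < ?u i else ?u j < ?u i"
      proof (cases "j \<in> T")
        case True
        then have "j \<noteq> 0" using T by (metis subsetD)
        then show ?thesis using lt[OF j] zj[of j] True j by (auto simp: L_def discounted_eq_max)
      qed (use lt[OF j] in \<open>auto simp: L_def\<close>)
    qed
    then show "\<exists>K\<subseteq>T - {i}. card K + of_bool (i \<in> T \<and> \<rho> \<le> r i) < rank_from_top k T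
      \<and> configuration v r T S \<rho> e (?u i) i K"
      using cd cL by (intro exI[of _ "L - {i}"]) (auto simp: L_def)
  next
    assume "\<exists>K\<subseteq>T - {i}. card K + of_bool (i \<in> T \<and> \<rho> \<le> r i) < rank_from_top k T
      \<and> configuration v r T S \<rho> e (?u i) i K"
    then obtain K where K: "K \<subseteq> T - {i}" "card K + of_bool (i \<in> T \<and> \<rho> \<le> r i) < rank_from_top k T"
      "configuration v r T S \<rho> e (?u i) i K" by blast
    have lt: "?u j < ?u i" if j: "j \<in> insert 0 S - {i}" for j
    proof -
      have *: "if j \<in> K then ?u j < ?u i \<and> ?u i < ?y j
          else if j \<in> T then ?y j < ?u i else ?u j < ?u i"
        using K(3) j unfolding configuration_def by blast
      show ?thesis
      proof (cases "j \<in> T")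
        case True
        then have "j \<noteq> 0" using T by (metis subsetD)
        then show ?thesis using * by (auto simp: discounted_eq_max split: if_splits)
      qed (use * K(1) in \<open>auto split: if_splits\<close>)
    qed
    have "K = {j\<in>T - {i}. ?u i < ?y j}"
      using configuration_unique[OF T(3) K(1,3)] .
    \<comment> \<open>All full-price utilities lie below that of \<open>i\<close>, so
      \<open>discounted\<close> can exceed it only through the opaque price.\<close>
    also have "\<dots> = L - {i}"
    proof -
      have "?u i < ?y j \<longleftrightarrow> ?u i \<le> ?z j" if "j \<in> T - {i}" for j
      proof -
        have "j \<in> insert 0 S - {i}" "j \<noteq> 0" using that T by (blast, metis DiffE subsetD)
        then show ?thesis using lt[of j] zj[OF that] by (auto simp: discounted_eq_max)
      qed
      then show ?thesis by (auto simp: L_def)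
    qed
    finally have "card L < rank_from_top k T" using cL K(2) by simp
    moreover have "\<forall>j\<in>insert 0 S. ?u j \<le> ?u i" using lt by force
    ultimately show "chooses k v r T S \<rho> e i"
      using chooses_iff[OF T(1,2)] i by (auto simp: L_def)
  qed
qed

text \<open>Removing the largest element lowers every remaining rank by one, which drives the
  induction on \<open>m\<close>. It supplies the product whose valuation the opaque product
  inherits.\<close>

lemma exists_rank:
  fixes z :: "'b \<Rightarrow> 'c::linorder"
  assumes "finite T" "inj_on z T" "0 < m" "m \<le> card T"
  shows "\<exists>i\<in>T. card {j\<in>T. z i < z j} + 1 = m"
  using assms
proof (induction m arbitrary: T)
  case 0
  then show ?case by simp
next
  case (Suc m)
  then have ne: "z ` T \<noteq> {}" by auto
  obtain a where a: "a \<in> T" "z a = Max (z ` T)"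
    using Max_in[OF _ ne] Suc.prems(1) by auto
  have amax: "z j \<le> z a" if "j \<in> T" for j using a that Suc.prems(1) by simp
  show ?case
  proof (cases "m = 0")
    case True
    have "{j\<in>T. z a < z j} = {}" using amax by (auto simp: not_less)
    then have "card {j\<in>T. z a < z j} = 0" by (metis card.empty)
    then show ?thesis using True a(1) by (intro bexI[of _ a]) simp_all
  next
    case False
    have "\<exists>i\<in>T - {a}. card {j\<in>T - {a}. z i < z j} + 1 = m"
      using Suc.prems False a by (intro Suc.IH) (auto intro: inj_on_subset)
    then obtain i where i: "i \<in> T - {a}" "card {j\<in>T - {a}. z i < z j} + 1 = m" by blast
    have "z i < z a" using amax[of i] i a Suc.prems(2) by (metis DiffE inj_onD insertI1 less_le)
    then have "{j\<in>T. z i < z j} = insert a {j\<in>T - {a}. z i < z j}" using a by auto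
    then show ?thesis using i Suc.prems(1) by (intro bexI[of _ i]) auto
  qed
qed

text \<open>Here \<open>i\<close> is the product of \<open>T\<close> at the rank that defines the
  opaque product, and the winning level is the utility of \<open>i\<close> at the opaque price. This
  is why \<open>card K + 1\<close> equals the rank, where a full-price winner only has an upper
  bound.\<close>

lemma chooses_opaque_iff_configuration:
  assumes T: "finite T" "1 \<le> k" "T \<subseteq> S" "0 \<notin> S" and nt: "no_ties v r T S \<rho> e"
  shows "chooses_opaque k v r T S \<rho> e \<longleftrightarrow>
    (\<exists>i\<in>T. \<rho> \<le> r i \<and> (\<exists>K\<subseteq>T - {i}. card K + 1 = rank_from_top k T
      \<and> configuration v r T S \<rho> e (discounted v r e \<rho> i) i K))"
proof -
  let ?u = "utility v r e" and ?y = "discounted v r e \<rho>" and ?m = "rank_from_top k T"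
  let ?z = "\<lambda>j. valuation v e j - \<rho>"
  have inj: "inj_on ?z T"
  proof (rule inj_onI)
    fix i j assume "i \<in> T" "j \<in> T" and eq: "?z i = ?z j"
    moreover from this have "i \<in> insert 0 S" "j \<in> insert 0 S" using T(3) by auto
    ultimately show "i = j" using nt eq unfolding no_ties_def by fastforce
  qed
  note iff = chooses_opaque_iff[OF T(1,2), of v r S \<rho> e]
  show ?thesis
  proof
    assume ch: "chooses_opaque k v r T S \<rho> e"
    \<comment> \<open>The no-purchase option is always available, and beating it already shows that
      \<open>T\<close> has enough elements for a product of this rank to exist.\<close>
    have "?m \<le> card {j\<in>T. ?u 0 \<le> ?z j}"
      using ch[unfolded iff] by (rule bspec) simp
    also have "\<dots> \<le> card T" using T by (intro card_mono) auto
    finally obtain i where i: "i \<in> T" "card {j\<in>T. ?z i < ?z j} + 1 = ?m"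
      using exists_rank[OF T(1) inj rank_from_top_pos] by blast
    define K where "K = {j\<in>T. ?z i < ?z j}"
    \<comment> \<open>A full-price utility above \<open>?z i\<close> could be reached at the opaque
      price only by products ranked above \<open>i\<close>, and there are just \<open>?m - 1\<close>
      of them.\<close>
    have zu: "?u j \<le> ?z i" if "j \<in> insert 0 S" for j
    proof (rule ccontr)
      assume "\<not> ?u j \<le> ?z i"
      then have "{j'\<in>T. ?u j \<le> ?z j'} \<subseteq> {j\<in>T. ?z i < ?z j}" by auto
      then have "card {j'\<in>T. ?u j \<le> ?z j'} \<le> card {j\<in>T. ?z i < ?z j}"
        using T by (intro card_mono) auto
      moreover have "?m \<le> card {j'\<in>T. ?u j \<le> ?z j'}"
        using ch[unfolded iff] that by (rule bspec)
      ultimately show False using i(2) by simp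
    qed
    have i0: "i \<noteq> 0" "i \<in> insert 0 S" using i(1) T by (metis subsetD, auto)
    \<comment> \<open>The opaque product beats in particular \<open>i\<close> at its own full
      price.\<close>
    have "\<rho> \<le> r i" using zu[OF i0(2)] i0 by (simp add: utility_def)
    then have yi: "?y i = ?z i" by (simp add: discounted_def)
    have lt: "?u j < ?z i" if "j \<in> insert 0 S - {i}" for j
    proof -
      have "j \<in> insert 0 S" "i \<noteq> j" using that by auto
      then have "?z i \<noteq> ?u j" using nt i(1) i0(2) unfolding no_ties_def by blast
      then show ?thesis using zu[OF \<open>j \<in> insert 0 S\<close>] by linarith
    qed
    have zlt: "?z i \<noteq> ?z j" if "j \<in> T - {i}" for j
      using inj_onD[OF inj _ i(1), of j] that by blast
    have "configuration v r T S \<rho> e (?y i) i K"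
      unfolding configuration_def yi
    proof (intro ballI)
      fix j assume j: "j \<in> insert 0 S - {i}"
      show "if j \<in> K then ?u j < ?z i \<and> ?z i < ?y j
          else if j \<in> T then ?y j < ?z i else ?u j < ?z i"
      proof (cases "j \<in> T")
        case True
        then have "j \<noteq> 0" using T by (metis subsetD)
        then show ?thesis using lt[OF j] zlt[of j] True j by (auto simp: K_def discounted_eq_max)
      qed (use lt[OF j] in \<open>auto simp: K_def\<close>)
    qed
    moreover have "K \<subseteq> T - {i}" "card K + 1 = ?m" using i(2) by (auto simp: K_def)
    ultimately show "\<exists>i\<in>T. \<rho> \<le> r i \<and> (\<exists>K\<subseteq>T - {i}. card K + 1 = ?m
      \<and> configuration v r T S \<rho> e (?y i) i K)"
      using i(1) \<open>\<rho> \<le> r i\<close> by metis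
  next
    assume "\<exists>i\<in>T. \<rho> \<le> r i \<and> (\<exists>K\<subseteq>T - {i}. card K + 1 = ?m
      \<and> configuration v r T S \<rho> e (?y i) i K)"
    then obtain i K where i: "i \<in> T" "\<rho> \<le> r i" and K: "K \<subseteq> T - {i}" "card K + 1 = ?m"
      "configuration v r T S \<rho> e (?y i) i K" by blast
    have yi: "?y i = ?z i" using i by (simp add: discounted_def)
    have zu: "?u j \<le> ?z i" if "j \<in> insert 0 S" for j
    proof (cases "j = i")
      case True
      then show ?thesis using i T by (auto simp: utility_def)
    next
      case False
      with that K(3) have *: "if j \<in> K then ?u j < ?y i \<and> ?y i < ?y j
          else if j \<in> T then ?y j < ?y i else ?u j < ?y i"
        unfolding configuration_def by blast
      show ?thesis
      proof (cases "j \<in> T")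
        case True
        then have "j \<noteq> 0" using T by (metis subsetD)
        then show ?thesis using * by (auto simp: yi discounted_eq_max split: if_splits)
      qed (use * K(1) in \<open>auto simp: yi split: if_splits\<close>)
    qed
    have Kz: "?z i < ?z j" if "j \<in> K" for j
    proof -
      have "j \<in> insert 0 S - {i}" "j \<noteq> 0" using that K(1) T by (blast, metis DiffE subsetD)
      then have "if j \<in> K then ?u j < ?z i \<and> ?z i < ?y j
          else if j \<in> T then ?y j < ?z i else ?u j < ?z i"
        using K(3) unfolding configuration_def yi by blast
      then have "?u j < ?z i \<and> ?z i < ?y j" using that by simp
      then show ?thesis using \<open>j \<noteq> 0\<close> by (auto simp: discounted_eq_max)
    qed
    have "?m \<le> card {j'\<in>T. ?u j \<le> ?z j'}" if "j \<in> insert 0 S" for j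
    proof -
      have "finite K" "i \<notin> K" using K(1) T(1) by (auto intro: finite_subset)
      \<comment> \<open>The required \<open>?m\<close> products are \<open>i\<close> and those
        ranked above it; all of them reach every full-price utility.\<close>
      then have "?m = card (insert i K)" using K(2) by simp
      also have "\<dots> \<le> card {j'\<in>T. ?u j \<le> ?z j'}"
      proof (rule card_mono)
        have "?u j \<le> ?z j'" if "j' \<in> K" for j'
          using Kz[OF that] zu[OF \<open>j \<in> insert 0 S\<close>] by linarith
        then show "insert i K \<subseteq> {j'\<in>T. ?u j \<le> ?z j'}"
          using K(1) zu[OF that] i(1) by blast
      qed (use T(1) in simp)
      finally show ?thesis .
    qed
    then show "chooses_opaque k v r T S \<rho> e"
      unfolding iff by blast
  qed
qed

text \<open>The cardinality of \<open>K\<close> is the number of products of \<open>T\<close> above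
  the level, and it strictly drops as the level rises from one product to a higher one. Equal
  cardinalities thus force equal levels, and a configuration leaves no second product at its
  level.\<close>

lemma configuration_rank_unique:
  assumes T: "finite T" "T \<subseteq> S" "0 \<notin> S"
    and i: "i \<in> T" "K \<subseteq> T - {i}" "configuration v r T S \<rho> e (discounted v r e \<rho> i) i K"
    and i': "i' \<in> T" "K' \<subseteq> T - {i'}" "configuration v r T S \<rho> e (discounted v r e \<rho> i') i' K'"
    and "card K = card K'"
  shows "i = i'"
proof -
  let ?y = "discounted v r e \<rho>"
  have K: "K = {j\<in>T - {i}. ?y i < ?y j}" and K': "K' = {j\<in>T - {i'}. ?y i' < ?y j}"
    by (rule configuration_unique[OF T(2) i(2,3)], rule configuration_unique[OF T(2) i'(2,3)])
  \<comment> \<open>The inclusion is strict because \<open>b\<close> is counted above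
    \<open>a\<close> but not above itself.\<close>
  have less: "card {j\<in>T - {b}. ?y b < ?y j} < card {j\<in>T - {a}. ?y a < ?y j}"
    if "a \<in> T" "b \<in> T" "?y a < ?y b" for a b
  proof (rule psubset_card_mono)
    have "b \<in> {j\<in>T - {a}. ?y a < ?y j}" "b \<notin> {j\<in>T - {b}. ?y b < ?y j}" using that by auto
    moreover have "{j\<in>T - {b}. ?y b < ?y j} \<subseteq> {j\<in>T - {a}. ?y a < ?y j}"
      using that by (auto intro: less_trans)
    ultimately show "{j\<in>T - {b}. ?y b < ?y j} \<subset> {j\<in>T - {a}. ?y a < ?y j}" by blast
  qed (use T(1) in simp)
  have "\<not> ?y i < ?y i'" "\<not> ?y i' < ?y i"
    using less[OF i(1) i'(1), folded K K'] less[OF i'(1) i(1), folded K K'] \<open>card K = card K'\<close> by linarith+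
  then have eq: "?y i = ?y i'" by simp
  show ?thesis
  proof (rule ccontr)
    assume ne: "i \<noteq> i'"
    then have "i' \<in> insert 0 S - {i}" using i'(1) T(2) by blast
    \<comment> \<open>A product at the same level is not strictly above it; outside \<open>K\<close>
      it would have to be strictly below.\<close>
    moreover have "i' \<notin> K" using configuration_unique[OF T(2) i(2,3)] eq by force
    ultimately have "?y i' < ?y i" using i(3) i'(1) unfolding configuration_def by (metis (no_types, lifting))
    with eq show False by simp
  qed
qed

section \<open>Gumbel noise\<close>

definition gumbel :: "real measure" where
  "gumbel = density lborel (\<lambda>x. ennreal (std_gumbel_density x))"

definition gumbel_cdf :: "real \<Rightarrow> real" where
  "gumbel_cdf x = exp (- exp (- x))"

lemma sets_gumbel [measurable_cong, simp]: "sets gumbel = sets borel"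
  by (simp add: gumbel_def)

lemma space_gumbel [simp]: "space gumbel = UNIV"
  by (simp add: gumbel_def)

text \<open>Splits off the factor on which a shift of the argument acts by a constant; the other
  factor joins the distribution functions of the remaining options.\<close>

lemma std_gumbel_density_eq: "std_gumbel_density x = exp (- x) * gumbel_cdf x"
  by (simp add: std_gumbel_density_def gumbel_cdf_def exp_add[symmetric])

lemma measurable_std_gumbel_density [measurable]: "std_gumbel_density \<in> borel_measurable borel"
  unfolding std_gumbel_density_def by measurable

lemma measurable_gumbel_cdf [measurable]: "gumbel_cdf \<in> borel_measurable borel"
  unfolding gumbel_cdf_def by measurable

lemma gumbel_cdf_bounds: "0 < gumbel_cdf x" "gumbel_cdf x \<le> 1"
  by (auto simp: gumbel_cdf_def)

lemma gumbel_cdf_mono: "x \<le> y \<Longrightarrow> gumbel_cdf x \<le> gumbel_cdf y"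
  by (simp add: gumbel_cdf_def)

lemma emeasure_gumbel_singleton: "emeasure gumbel {c} = 0"
  by (simp add: gumbel_def emeasure_density)

lemma emeasure_gumbel_atLeast: "emeasure gumbel {a..} = ennreal (1 - gumbel_cdf a)"
proof -
  have "emeasure gumbel {a..}
      = (\<integral>\<^sup>+x. ennreal (std_gumbel_density x) * indicator {a..} x \<partial>lborel)"
    by (simp add: gumbel_def emeasure_density)
  also have "\<dots> = ennreal (1 - gumbel_cdf a)"
  proof (rule nn_integral_FTC_atLeast)
    show "DERIV gumbel_cdf x :> std_gumbel_density x" for x
      unfolding gumbel_cdf_def std_gumbel_density_eq
      by (auto intro!: derivative_eq_intros)
    have "((\<lambda>x::real. exp (- exp (- x))) \<longlongrightarrow> exp (- 0)) at_top"
      by (intro tendsto_intros filterlim_compose[OF exp_at_bot] filterlim_uminus_at_bot_at_top)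
    then show "(gumbel_cdf \<longlongrightarrow> 1) at_top"
      by (simp add: gumbel_cdf_def[abs_def])
  qed (auto simp: std_gumbel_density_def)
  finally show ?thesis .
qed

text \<open>By complement. Total mass 1 is a hypothesis, later obtained from the law of a noise
  term, so no limit at minus infinity has to be computed.\<close>

lemma emeasure_gumbel_lessThan:
  assumes "prob_space gumbel"
  shows "emeasure gumbel {..<a} = ennreal (gumbel_cdf a)"
proof -
  interpret G: prob_space gumbel by fact
  have "{..<a} = space gumbel - {a..}" by auto
  then have "emeasure gumbel {..<a} = emeasure gumbel (space gumbel) - emeasure gumbel {a..}"
    using emeasure_compl[of "{a..}" gumbel] emeasure_gumbel_atLeast[of a] by simp
  also have "\<dots> = ennreal 1 - ennreal (1 - gumbel_cdf a)"
    using G.emeasure_space_1 by (simp add: emeasure_gumbel_atLeast)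
  also have "\<dots> = ennreal (gumbel_cdf a)"
    using gumbel_cdf_bounds[of a] by (subst ennreal_minus) auto
  finally show ?thesis .
qed

lemma emeasure_gumbel_greaterThanLessThan:
  assumes "prob_space gumbel" "a \<le> b"
  shows "emeasure gumbel {a<..<b} = ennreal (gumbel_cdf b - gumbel_cdf a)"
proof (cases "a = b")
  case False
  interpret G: prob_space gumbel by fact
  have "{a<..<b} = {..<b} - ({..<a} \<union> {a})" by auto
  moreover have e: "emeasure gumbel ({..<a} \<union> {a}) = ennreal (gumbel_cdf a)"
    using emeasure_gumbel_lessThan[OF assms(1)] emeasure_gumbel_singleton[of a]
    by (subst plus_emeasure[symmetric]) auto
  ultimately have "emeasure gumbel {a<..<b}
      = emeasure gumbel {..<b} - emeasure gumbel ({..<a} \<union> {a})"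
    using assms(2) False by (simp only:) (subst emeasure_Diff, auto)
  also have "\<dots> = ennreal (gumbel_cdf b - gumbel_cdf a)"
    unfolding e emeasure_gumbel_lessThan[OF assms(1)]
    using gumbel_cdf_bounds(1)[of a] by (subst ennreal_minus) auto
  finally show ?thesis .
qed simp

section \<open>Independent Gumbel noise and the law of its differences\<close>

locale gumbel_noise = prob_space M for M :: "'a measure" +
  fixes \<epsilon> :: "nat \<Rightarrow> 'a \<Rightarrow> real" and n :: nat
  assumes indep: "indep_vars (\<lambda>_. borel) \<epsilon> {0..n}"
    and dist: "\<And>i. i \<in> {0..n} \<Longrightarrow> distributed M lborel (\<epsilon> i) std_gumbel_density"
begin

lemma measurable_noise: "i \<le> n \<Longrightarrow> \<epsilon> i \<in> borel_measurable M"
  using dist[of i] by (auto simp: distributed_def)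

lemma distr_noise: "i \<le> n \<Longrightarrow> distr M borel (\<epsilon> i) = gumbel"
  using distributed_distr_eq_density[OF dist[of i]]
  by (simp add: gumbel_def cong: distr_cong)

lemma prob_space_gumbel: "prob_space gumbel"
  using prob_space_distr[OF measurable_noise[of 0]] distr_noise[of 0] by simp

text \<open>By independence the joint law is a product measure, and the coordinate \<open>i\<close>
  is integrated last. Once its value \<open>y\<close> is fixed, the remaining conditions describe a
  box.\<close>

lemma emeasure_differences:
  assumes I: "I \<subseteq> {0..n}" "i \<in> I" and B: "\<And>j. j \<in> I - {i} \<Longrightarrow> B j \<in> sets borel"
  shows "emeasure M {\<omega>\<in>space M. \<forall>j\<in>I - {i}. \<epsilon> j \<omega> - \<epsilon> i \<omega> \<in> B j}
    = (\<integral>\<^sup>+y. (\<Prod>j\<in>I - {i}. emeasure gumbel {z. z - y \<in> B j}) \<partial>gumbel)"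
proof -
  interpret G: prob_space gumbel by (rule prob_space_gumbel)
  interpret P: product_sigma_finite "\<lambda>_::nat. gumbel"
    by (simp add: product_sigma_finite_def G.sigma_finite_measure_axioms)
  have fin: "finite I" using I finite_subset by blast
  have rv: "\<epsilon> j \<in> borel_measurable M" if "j \<in> I" for j
    using that I(1) by (intro measurable_noise) auto
  let ?X = "\<lambda>\<omega>. \<lambda>j\<in>I. \<epsilon> j \<omega>"
  have X: "?X \<in> M \<rightarrow>\<^sub>M Pi\<^sub>M I (\<lambda>_. borel)"
    using rv by (intro measurable_restrict)
  have "distr M (Pi\<^sub>M I (\<lambda>_. borel)) ?X = Pi\<^sub>M I (\<lambda>j. distr M borel (\<epsilon> j))"
    using indep_vars_subset[OF indep I(1)] I rv indep_vars_iff_distr_eq_PiM'[of I \<epsilon> "\<lambda>_. borel"]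
    by blast
  also have "\<dots> = Pi\<^sub>M I (\<lambda>_. gumbel)"
    using I(1) distr_noise by (intro PiM_cong) auto
  finally have distr: "distr M (Pi\<^sub>M I (\<lambda>_. borel)) ?X = Pi\<^sub>M I (\<lambda>_. gumbel)" .
  let ?A = "{x\<in>space (Pi\<^sub>M I (\<lambda>_. borel :: real measure)). \<forall>j\<in>I - {i}. x j - x i \<in> B j}"
  have A: "?A \<in> sets (Pi\<^sub>M I (\<lambda>_. borel))"
  proof (intro sets.sets_Collect_finite_All)
    fix j assume j: "j \<in> I - {i}"
    have [measurable]: "(\<lambda>x. x j) \<in> borel_measurable (Pi\<^sub>M I (\<lambda>_. borel))"
      "(\<lambda>x. x i) \<in> borel_measurable (Pi\<^sub>M I (\<lambda>_. borel))" "B j \<in> sets borel"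
      using j I B by auto
    show "{x\<in>space (Pi\<^sub>M I (\<lambda>_. borel :: real measure)). x j - x i \<in> B j} \<in> sets (Pi\<^sub>M I (\<lambda>_. borel))"
      by measurable
  qed (use fin in auto)
  have sets_eq: "sets (Pi\<^sub>M I (\<lambda>_. gumbel)) = sets (Pi\<^sub>M I (\<lambda>_. borel))"
    by (intro sets_PiM_cong) auto
  have "emeasure M {\<omega>\<in>space M. \<forall>j\<in>I - {i}. \<epsilon> j \<omega> - \<epsilon> i \<omega> \<in> B j} = emeasure M (?X -` ?A \<inter> space M)"
    using I by (intro arg_cong[where f="emeasure M"]) (auto simp: space_PiM)
  also have "\<dots> = emeasure (Pi\<^sub>M I (\<lambda>_. gumbel)) ?A"
    using emeasure_distr[OF X A] distr by simp
  \<comment> \<open>The index set is written as \<open>insert i (I - {i})\<close> to prepare for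
    splitting off the coordinate \<open>i\<close>.\<close>
  also have "\<dots> = (\<integral>\<^sup>+x. indicator ?A x \<partial>Pi\<^sub>M (insert i (I - {i})) (\<lambda>_. gumbel))"
    using A sets_eq I(2) by (simp add: insert_absorb)
  also have "\<dots> = (\<integral>\<^sup>+y. (\<integral>\<^sup>+x. indicator ?A (x(i := y)) \<partial>Pi\<^sub>M (I - {i}) (\<lambda>_. gumbel)) \<partial>gumbel)"
    using A sets_eq I(2) fin
    by (intro P.product_nn_integral_insert_rev) (auto simp: insert_absorb)
  also have "\<dots> = (\<integral>\<^sup>+y. (\<Prod>j\<in>I - {i}. emeasure gumbel {z. z - y \<in> B j}) \<partial>gumbel)"
  proof (intro nn_integral_cong)
    fix y
    have meas: "{z. z - y \<in> B j} \<in> sets gumbel" if "j \<in> I - {i}" for j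
    proof -
      have [measurable]: "B j \<in> sets borel" using B that by simp
      have "{z\<in>space borel. z - y \<in> B j} \<in> sets borel" by measurable
      then show ?thesis by simp
    qed
    have "(\<integral>\<^sup>+x. indicator ?A (x(i := y)) \<partial>Pi\<^sub>M (I - {i}) (\<lambda>_. gumbel))
      = (\<integral>\<^sup>+x. indicator (Pi\<^sub>E (I - {i}) (\<lambda>j. {z. z - y \<in> B j})) x \<partial>Pi\<^sub>M (I - {i}) (\<lambda>_. gumbel))"
    proof (intro nn_integral_cong)
      fix x assume x: "x \<in> space (Pi\<^sub>M (I - {i}) (\<lambda>_. gumbel))"
      then have "x(i := y) \<in> space (Pi\<^sub>M I (\<lambda>_. borel :: real measure))"
        using I by (auto simp: space_PiM PiE_iff extensional_def)
      moreover have "x \<in> extensional (I - {i})" using x by (auto simp: space_PiM PiE_iff)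
      ultimately have "x(i := y) \<in> ?A \<longleftrightarrow> x \<in> Pi\<^sub>E (I - {i}) (\<lambda>j. {z. z - y \<in> B j})"
        by (auto simp: PiE_iff)
      then show "indicator ?A (x(i := y))
          = (indicator (Pi\<^sub>E (I - {i}) (\<lambda>j. {z. z - y \<in> B j})) x :: ennreal)"
        by (simp add: indicator_def)
    qed
    also have "\<dots> = emeasure (Pi\<^sub>M (I - {i}) (\<lambda>_. gumbel)) (Pi\<^sub>E (I - {i}) (\<lambda>j. {z. z - y \<in> B j}))"
      using fin meas by (intro nn_integral_indicator sets_PiM_I_finite) auto
    also have "\<dots> = (\<Prod>j\<in>I - {i}. emeasure gumbel {z. z - y \<in> B j})"
      using fin meas by (intro P.emeasure_PiM) auto
    finally show "(\<integral>\<^sup>+x. indicator ?A (x(i := y)) \<partial>Pi\<^sub>M (I - {i}) (\<lambda>_. gumbel))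
      = (\<Prod>j\<in>I - {i}. emeasure gumbel {z. z - y \<in> B j})" .
  qed
  finally show ?thesis .
qed

text \<open>The substitution \<open>x = y + a\<close> pulls the factor \<open>exp a\<close> out of the density of the
  leading noise term; this is where the Gumbel law enters.\<close>

lemma prob_differences:
  assumes I: "I \<subseteq> {0..n}" "i \<in> I" and B: "\<And>j. j \<in> I - {i} \<Longrightarrow> B j \<in> sets borel"
    and g: "\<And>j x. j \<in> I - {i} \<Longrightarrow> emeasure gumbel {z. z - x \<in> B j} = ennreal (g j x)"
    and g0: "\<And>j x. j \<in> I - {i} \<Longrightarrow> 0 \<le> g j x"
    and gm: "\<And>j. j \<in> I - {i} \<Longrightarrow> g j \<in> borel_measurable borel"
  shows "prob {\<omega>\<in>space M. \<forall>j\<in>I - {i}. \<epsilon> j \<omega> - (a + \<epsilon> i \<omega>) \<in> B j}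
    = exp a * (\<integral>x. exp (- x) * (gumbel_cdf (x - a) * (\<Prod>j\<in>I - {i}. g j x)) \<partial>lborel)"
proof -
  define p where "p x = (\<Prod>j\<in>I - {i}. g j x)" for x
  have p0: "0 \<le> p x" for x unfolding p_def using g0 by (intro prod_nonneg) auto
  have pm [measurable]: "p \<in> borel_measurable borel"
    unfolding p_def using gm by (intro borel_measurable_prod) auto
  let ?B = "\<lambda>j. {z. z - a \<in> B j}"
  have B': "?B j \<in> sets borel" if "j \<in> I - {i}" for j
  proof -
    have [measurable]: "B j \<in> sets borel" using B that by simp
    have "{z\<in>space borel. z - a \<in> B j} \<in> sets borel" by measurable
    then show ?thesis by simp
  qed
  have "emeasure M {\<omega>\<in>space M. \<forall>j\<in>I - {i}. \<epsilon> j \<omega> - (a + \<epsilon> i \<omega>) \<in> B j}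
    = emeasure M {\<omega>\<in>space M. \<forall>j\<in>I - {i}. \<epsilon> j \<omega> - \<epsilon> i \<omega> \<in> ?B j}"
    by (simp add: algebra_simps)
  also have "\<dots> = (\<integral>\<^sup>+y. (\<Prod>j\<in>I - {i}. emeasure gumbel {z. z - y \<in> ?B j}) \<partial>gumbel)"
    by (rule emeasure_differences[OF I B'])
  also have "\<dots> = (\<integral>\<^sup>+y. ennreal (p (a + y)) \<partial>gumbel)"
  proof (intro nn_integral_cong)
    fix y
    have "{z. z - y \<in> ?B j} = {z. z - (a + y) \<in> B j}" for j by (simp add: algebra_simps)
    then have "(\<Prod>j\<in>I - {i}. emeasure gumbel {z. z - y \<in> ?B j}) = (\<Prod>j\<in>I - {i}. ennreal (g j (a + y)))"
      using g by (intro prod.cong) auto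
    also have "\<dots> = ennreal (p (a + y))"
      unfolding p_def using g0 by (intro prod_ennreal) auto
    finally show "(\<Prod>j\<in>I - {i}. emeasure gumbel {z. z - y \<in> ?B j}) = ennreal (p (a + y))" .
  qed
  also have "\<dots> = (\<integral>\<^sup>+y. ennreal (std_gumbel_density y) * ennreal (p (a + y)) \<partial>lborel)"
    unfolding gumbel_def by (intro nn_integral_density) auto
  also have "\<dots> = (\<integral>\<^sup>+y. ennreal (std_gumbel_density y * p (a + y)) \<partial>lborel)"
    using p0 by (intro nn_integral_cong ennreal_mult[symmetric]) (auto simp: std_gumbel_density_def)
  also have "\<dots> = (\<integral>\<^sup>+x. ennreal (std_gumbel_density (x - a) * p x) \<partial>lborel)"
    by (subst (2) nn_integral_real_affine[where c=1 and t=a]) auto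
  also have "\<dots> = (\<integral>\<^sup>+x. ennreal (exp a * (exp (- x) * (gumbel_cdf (x - a) * p x))) \<partial>lborel)"
  proof (intro nn_integral_cong)
    fix x
    have "std_gumbel_density (x - a) * p x = exp a * (exp (- x) * (gumbel_cdf (x - a) * p x))"
    proof -
      have "exp (- (x - a)) = exp a * exp (- x)" by (simp add: exp_add[symmetric])
      then show ?thesis by (simp only: std_gumbel_density_eq mult.assoc)
    qed
    then show "ennreal (std_gumbel_density (x - a) * p x)
      = ennreal (exp a * (exp (- x) * (gumbel_cdf (x - a) * p x)))" by (rule arg_cong)
  qed
  finally have "prob {\<omega>\<in>space M. \<forall>j\<in>I - {i}. \<epsilon> j \<omega> - (a + \<epsilon> i \<omega>) \<in> B j}
    = (\<integral>x. exp a * (exp (- x) * (gumbel_cdf (x - a) * p x)) \<partial>lborel)"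
    unfolding measure_def
    by (subst integral_eq_nn_integral) (auto simp: p0 gumbel_cdf_bounds(1)[THEN less_imp_le])
  also have "\<dots> = exp a * (\<integral>x. exp (- x) * (gumbel_cdf (x - a) * p x) \<partial>lborel)"
    by (rule integral_mult_right_zero)
  finally show ?thesis by (simp only: p_def)
qed

text \<open>Given the noise at \<open>i\<close>, the equation confines the noise at \<open>j\<close>
  to a single point, and the Gumbel law has no atoms.\<close>

lemma AE_difference_ne:
  assumes "i \<le> n" "j \<le> n" "i \<noteq> j"
  shows "AE \<omega> in M. \<epsilon> j \<omega> - \<epsilon> i \<omega> \<noteq> c"
proof -
  have [measurable]: "\<epsilon> i \<in> borel_measurable M" "\<epsilon> j \<in> borel_measurable M"
    using assms measurable_noise by auto
  have "emeasure M {\<omega>\<in>space M. \<forall>j\<in>{i, j} - {i}. \<epsilon> j \<omega> - \<epsilon> i \<omega> \<in> {c}}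
    = (\<integral>\<^sup>+y. (\<Prod>j\<in>{i, j} - {i}. emeasure gumbel {z. z - y \<in> {c}}) \<partial>gumbel)"
    using assms by (intro emeasure_differences) auto
  moreover have "{i, j} - {i} = {j}" using assms by auto
  moreover have "{z. z - y \<in> {c}} = {c + y}" for y :: real by auto
  ultimately have "emeasure M {\<omega>\<in>space M. \<epsilon> j \<omega> - \<epsilon> i \<omega> = c} = 0"
    by (simp add: emeasure_gumbel_singleton)
  then have "AE \<omega> in M. \<not> (\<epsilon> j \<omega> - \<epsilon> i \<omega> = c)"
    by (intro AE_I[of _ _ "{\<omega>\<in>space M. \<epsilon> j \<omega> - \<epsilon> i \<omega> = c}"]) auto
  then show ?thesis .
qed

end

section \<open>Choice probabilities\<close>

text \<open>The deterministic part of the utility; its exponential is the MNL weight of the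
  option.\<close>

definition base_shift :: "(nat \<Rightarrow> real) \<Rightarrow> (nat \<Rightarrow> real) \<Rightarrow> nat \<Rightarrow> real" where
  "base_shift v r i = (if i = 0 then 0 else v i - r i)"

definition low_shift :: "(nat \<Rightarrow> real) \<Rightarrow> (nat \<Rightarrow> real) \<Rightarrow> real \<Rightarrow> nat \<Rightarrow> real" where
  "low_shift v r \<rho> i = v i - min (r i) \<rho>"

text \<open>For \<open>K \<subseteq> T\<close> without the option 0, this is the probability that
  the noise of \<open>j\<close> satisfies the clause of \<open>configuration\<close> for
  \<open>j\<close> at level \<open>x\<close>.\<close>

definition config_factor :: "(nat \<Rightarrow> real) \<Rightarrow> (nat \<Rightarrow> real) \<Rightarrow> nat set \<Rightarrow> real
    \<Rightarrow> nat set \<Rightarrow> nat \<Rightarrow> real \<Rightarrow> real" where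
  "config_factor v r T \<rho> K j x =
     (if j \<in> K then gumbel_cdf (x - base_shift v r j) - gumbel_cdf (x - low_shift v r \<rho> j)
      else if j \<in> T then gumbel_cdf (x - low_shift v r \<rho> j)
      else gumbel_cdf (x - base_shift v r j))"

text \<open>The no-purchase option contributes \<open>gumbel_cdf x\<close> to the product, so this is the probability
  that it wins in configuration \<open>K\<close>.\<close>

definition config_weight :: "(nat \<Rightarrow> real) \<Rightarrow> (nat \<Rightarrow> real) \<Rightarrow> nat set \<Rightarrow> nat set \<Rightarrow> real
    \<Rightarrow> nat set \<Rightarrow> real" where
  "config_weight v r T S \<rho> K =
     (\<integral>x. exp (- x) * (\<Prod>j\<in>insert 0 S. config_factor v r T \<rho> K j x) \<partial>lborel)"

lemma utility_eq_shift: "utility v r e i = base_shift v r i + e i"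
  by (simp add: utility_def valuation_def base_shift_def)

lemma discounted_eq_shift: "i \<noteq> 0 \<Longrightarrow> discounted v r e \<rho> i = low_shift v r \<rho> i + e i"
  by (simp add: discounted_def valuation_def low_shift_def)

lemma base_le_low_shift: "i \<noteq> 0 \<Longrightarrow> base_shift v r i \<le> low_shift v r \<rho> i"
  by (simp add: base_shift_def low_shift_def)

lemma measurable_config_factor [measurable]: "config_factor v r T \<rho> K j \<in> borel_measurable borel"
  unfolding config_factor_def[abs_def] by measurable

lemma config_factor_bounds:
  assumes "0 \<notin> K"
  shows "0 \<le> config_factor v r T \<rho> K j x" "config_factor v r T \<rho> K j x \<le> 1"
proof -
  have "gumbel_cdf (x - low_shift v r \<rho> j) \<le> gumbel_cdf (x - base_shift v r j)" if "j \<in> K"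
    using that assms base_le_low_shift[of j v r \<rho>] by (intro gumbel_cdf_mono) (cases "j = 0", auto)
  moreover note gumbel_cdf_bounds[of "x - low_shift v r \<rho> j"] gumbel_cdf_bounds[of "x - base_shift v r j"]
  ultimately show "0 \<le> config_factor v r T \<rho> K j x" "config_factor v r T \<rho> K j x \<le> 1"
    unfolding config_factor_def by (auto split: if_splits)
qed

lemma integrable_gumbel_density:
  assumes "prob_space gumbel"
  shows "integrable lborel std_gumbel_density"
proof (rule integrableI_nonneg)
  interpret G: prob_space gumbel by fact
  have "(\<integral>\<^sup>+x. ennreal (std_gumbel_density x) \<partial>lborel) = emeasure gumbel (space gumbel)"
    by (simp add: gumbel_def emeasure_density)
  then show "(\<integral>\<^sup>+x. ennreal (std_gumbel_density x) \<partial>lborel) < \<infinity>"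
    using G.emeasure_space_1 by simp
qed (auto simp: std_gumbel_density_def)

section \<open>Probabilities of configurations for a fixed offer\<close>

locale opaque_offer = gumbel_noise M \<epsilon> n for M :: "'a measure" and \<epsilon> n +
  fixes k :: nat and v r :: "nat \<Rightarrow> real" and S T :: "nat set"
  assumes k_pos: "1 \<le> k" and S_sub: "S \<subseteq> {1..n}" and T_sub: "T \<subseteq> S"
begin

lemma finite_S: "finite S" and finite_T: "finite T" and zero_notin_S: "0 \<notin> S"
  and zero_notin_T: "0 \<notin> T"
  using S_sub T_sub finite_subset[of S "{1..n}"] finite_subset[of T S] by auto

lemma options_le: "i \<in> insert 0 S \<Longrightarrow> i \<le> n"
  using S_sub by auto

abbreviation (input) factor where "factor \<equiv> config_factor v r T"
abbreviation (input) weight where "weight \<equiv> config_weight v r T S"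
abbreviation (input) noise where "noise \<omega> \<equiv> (\<lambda>l. \<epsilon> l \<omega>)"
abbreviation (input) m where "m \<equiv> rank_from_top k T"

text \<open>The factor of the no-purchase option turns \<open>exp (- x)\<close> into the Gumbel
  density, and the other factors are at most 1. The bound is the same for every price, as dominated
  convergence will require.\<close>

lemma integrand_bounds:
  assumes "K \<subseteq> T"
  shows "0 \<le> exp (- x) * (\<Prod>j\<in>insert 0 S. factor \<rho> K j x)"
    "exp (- x) * (\<Prod>j\<in>insert 0 S. factor \<rho> K j x) \<le> std_gumbel_density x"
proof -
  have K0: "0 \<notin> K" using assms zero_notin_T by auto
  show "0 \<le> exp (- x) * (\<Prod>j\<in>insert 0 S. factor \<rho> K j x)"
    by (intro mult_nonneg_nonneg prod_nonneg config_factor_bounds(1)[OF K0]) auto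
  have "factor \<rho> K 0 x = gumbel_cdf x"
    using K0 zero_notin_T by (simp add: config_factor_def base_shift_def)
  then have "exp (- x) * (\<Prod>j\<in>insert 0 S. factor \<rho> K j x)
      = std_gumbel_density x * (\<Prod>j\<in>S. factor \<rho> K j x)"
    using finite_S zero_notin_S by (simp add: std_gumbel_density_eq)
  also have "\<dots> \<le> std_gumbel_density x * 1"
    using config_factor_bounds[OF K0]
    by (intro mult_left_mono prod_le_1) (auto simp: std_gumbel_density_def)
  finally show "exp (- x) * (\<Prod>j\<in>insert 0 S. factor \<rho> K j x) \<le> std_gumbel_density x" by simp
qed

lemma integrable_weight:
  assumes "K \<subseteq> T"
  shows "integrable lborel (\<lambda>x. exp (- x) * (\<Prod>j\<in>insert 0 S. factor \<rho> K j x))"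
  using integrable_gumbel_density[OF prob_space_gumbel]
proof (rule Bochner_Integration.integrable_bound)
  show "(\<lambda>x. exp (- x) * (\<Prod>j\<in>insert 0 S. factor \<rho> K j x)) \<in> borel_measurable lborel"
    by measurable
  show "AE x in lborel. norm (exp (- x) * (\<Prod>j\<in>insert 0 S. factor \<rho> K j x))
      \<le> norm (std_gumbel_density x)"
  proof (intro AE_I2)
    fix x
    note b = integrand_bounds[OF assms, of x \<rho>]
    show "norm (exp (- x) * (\<Prod>j\<in>insert 0 S. factor \<rho> K j x)) \<le> norm (std_gumbel_density x)"
      by (simp only: real_norm_def abs_of_nonneg[OF b(1)] abs_of_nonneg[OF order.trans[OF b]] b(2))
  qed
qed

lemma weight_nonneg: "K \<subseteq> T \<Longrightarrow> 0 \<le> weight \<rho> K"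
  unfolding config_weight_def by (rule Bochner_Integration.integral_nonneg) (rule integrand_bounds(1))

lemma configuration_iff_differences:
  assumes i: "i \<in> insert 0 S" "K \<subseteq> T - {i}"
  shows "configuration v r T S \<rho> e (a + e i) i K \<longleftrightarrow>
    (\<forall>j\<in>insert 0 S - {i}. e j - (a + e i) \<in>
       (if j \<in> K then {- low_shift v r \<rho> j<..<- base_shift v r j}
        else if j \<in> T then {..<- low_shift v r \<rho> j} else {..<- base_shift v r j}))"
  unfolding configuration_def
proof (intro ball_cong refl)
  fix j
  have j0: "j \<noteq> 0" if "j \<in> T" using that zero_notin_T by metis
  have KT: "j \<in> T" if "j \<in> K" using that i(2) by blast
  show "(if j \<in> K then utility v r e j < a + e i \<and> a + e i < discounted v r e \<rho> j
      else if j \<in> T then discounted v r e \<rho> j < a + e i else utility v r e j < a + e i) \<longleftrightarrow>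
    e j - (a + e i) \<in> (if j \<in> K then {- low_shift v r \<rho> j<..<- base_shift v r j}
        else if j \<in> T then {..<- low_shift v r \<rho> j} else {..<- base_shift v r j})"
    using j0 KT by (cases "j \<in> K"; cases "j \<in> T") (auto simp: utility_eq_shift discounted_eq_shift)
qed

text \<open>Each option other than \<open>i\<close> contributes one factor. The option
  \<open>i\<close> has no clause; its density supplies \<open>exp a\<close> and
  \<open>gumbel_cdf (x - a)\<close>.\<close>

lemma prob_configuration:
  assumes i: "i \<in> insert 0 S" "K \<subseteq> T - {i}"
  shows "prob {\<omega>\<in>space M. configuration v r T S \<rho> (noise \<omega>) (a + \<epsilon> i \<omega>) i K}
    = exp a * (\<integral>x. exp (- x) * (gumbel_cdf (x - a) * (\<Prod>j\<in>insert 0 S - {i}. factor \<rho> K j x)) \<partial>lborel)"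
proof -
  define B where "B j = (if j \<in> K then {- low_shift v r \<rho> j<..<- base_shift v r j}
        else if j \<in> T then {..<- low_shift v r \<rho> j} else {..<- base_shift v r j})" for j
  have K0: "0 \<notin> K" using i zero_notin_T by auto
  note lt = emeasure_gumbel_lessThan[OF prob_space_gumbel]
  have "emeasure gumbel {z. z - x \<in> B j} = ennreal (factor \<rho> K j x)" for j x
  proof -
    have "{z. z - x \<in> B j} = (if j \<in> K then {x - low_shift v r \<rho> j<..<x - base_shift v r j}
        else if j \<in> T then {..<x - low_shift v r \<rho> j} else {..<x - base_shift v r j})"
      by (auto simp: B_def)
    moreover have "emeasure gumbel {x - low_shift v r \<rho> j<..<x - base_shift v r j}
      = ennreal (gumbel_cdf (x - base_shift v r j) - gumbel_cdf (x - low_shift v r \<rho> j))" if "j \<in> K"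
      using that K0 base_le_low_shift[of j v r \<rho>]
      by (intro emeasure_gumbel_greaterThanLessThan prob_space_gumbel) (cases "j = 0", auto)
    ultimately show ?thesis by (auto simp: config_factor_def lt)
  qed
  moreover have "B j \<in> sets borel" for j by (auto simp: B_def)
  moreover have "insert 0 S \<subseteq> {0..n}" using S_sub by auto
  ultimately have "prob {\<omega>\<in>space M. \<forall>j\<in>insert 0 S - {i}. \<epsilon> j \<omega> - (a + \<epsilon> i \<omega>) \<in> B j}
    = exp a * (\<integral>x. exp (- x) * (gumbel_cdf (x - a) * (\<Prod>j\<in>insert 0 S - {i}. factor \<rho> K j x)) \<partial>lborel)"
    using i(1) config_factor_bounds(1)[OF K0] by (intro prob_differences) auto
  then show ?thesis
    using configuration_iff_differences[OF i, of \<rho> "noise _" a] by (simp add: B_def)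
qed

text \<open>At level \<open>utility\<close>, the missing factor of \<open>i\<close> is the
  distribution function at its full price. For \<open>i\<close> in \<open>T\<close> this is the sum
  of the factors that \<open>i\<close> has outside and inside the configuration set, which gives the
  two weights.\<close>

lemma prob_full_price_configuration:
  assumes i: "i \<in> insert 0 S" "K \<subseteq> T - {i}"
  shows "prob {\<omega>\<in>space M. configuration v r T S \<rho> (noise \<omega>) (utility v r (noise \<omega>) i) i K}
    = exp (base_shift v r i) * (weight \<rho> K + (if i \<in> T then weight \<rho> (insert i K) else 0))"
proof -
  let ?s = "base_shift v r i" and ?p = "\<lambda>x. \<Prod>j\<in>insert 0 S - {i}. factor \<rho> K j x"
  have prod: "(\<Prod>j\<in>insert 0 S. factor \<rho> L j x) = factor \<rho> L i x * ?p x" if "L = K \<or> L = insert i K" for L x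
  proof -
    have "(\<Prod>j\<in>insert 0 S. factor \<rho> L j x) = factor \<rho> L i x * (\<Prod>j\<in>insert 0 S - {i}. factor \<rho> L j x)"
      using i(1) finite_S by (intro prod.remove) auto
    also have "(\<Prod>j\<in>insert 0 S - {i}. factor \<rho> L j x) = ?p x"
      using that by (intro prod.cong) (auto simp: config_factor_def)
    finally show ?thesis .
  qed
  have "(\<integral>x. exp (- x) * (gumbel_cdf (x - ?s) * ?p x) \<partial>lborel)
    = weight \<rho> K + (if i \<in> T then weight \<rho> (insert i K) else 0)"
  proof (cases "i \<in> T")
    case True
    have "exp (- x) * (gumbel_cdf (x - ?s) * ?p x)
      = exp (- x) * (\<Prod>j\<in>insert 0 S. factor \<rho> K j x)
        + exp (- x) * (\<Prod>j\<in>insert 0 S. factor \<rho> (insert i K) j x)" for x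
    proof -
      have "factor \<rho> K i x + factor \<rho> (insert i K) i x = gumbel_cdf (x - ?s)"
        using i(2) True by (auto simp: config_factor_def)
      then show ?thesis
        by (simp only: prod[of K] prod[of "insert i K"] simp_thms) (metis distrib_left distrib_right)
    qed
    then show ?thesis
      using True i(2) by (simp only: config_weight_def if_True)
        (intro Bochner_Integration.integral_add integrable_weight; blast)
  next
    case False
    then have "factor \<rho> K i x = gumbel_cdf (x - ?s)" for x
      using i(2) by (auto simp: config_factor_def)
    then show ?thesis using False by (simp only: config_weight_def prod[of K] simp_thms if_False add_0_right)
  qed
  then show ?thesis
    using prob_configuration[OF i, of \<rho> ?s] by (simp only: utility_eq_shift)
qed

text \<open>At level \<open>discounted\<close>, the missing factor of \<open>i\<close> is exactly
  the one it has in \<open>config_weight\<close> as a member of \<open>T - K\<close>.\<close>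

lemma prob_low_price_configuration:
  assumes i: "i \<in> T" "K \<subseteq> T - {i}"
  shows "prob {\<omega>\<in>space M. configuration v r T S \<rho> (noise \<omega>) (discounted v r (noise \<omega>) \<rho> i) i K}
    = exp (low_shift v r \<rho> i) * weight \<rho> K"
proof -
  have i': "i \<in> insert 0 S" "i \<noteq> 0" using i T_sub zero_notin_T by (blast, metis)
  have "factor \<rho> K i x = gumbel_cdf (x - low_shift v r \<rho> i)" for x
    using i by (auto simp: config_factor_def)
  then have "(\<Prod>j\<in>insert 0 S. factor \<rho> K j x)
      = gumbel_cdf (x - low_shift v r \<rho> i) * (\<Prod>j\<in>insert 0 S - {i}. factor \<rho> K j x)" for x
    using i'(1) finite_S prod.remove[of "insert 0 S" i "\<lambda>j. factor \<rho> K j x"] by simp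
  then show ?thesis
    using prob_configuration[OF i'(1) i(2), of \<rho> "low_shift v r \<rho> i"] i'(2)
    by (simp only: config_weight_def discounted_eq_shift not_False_eq_True)
qed

text \<open>If the opaque price exceeds \<open>r i\<close> there is no discount, so no level fits
  between the full-price and the discounted utility of \<open>i\<close>.\<close>

lemma weight_eq_0:
  assumes "i \<in> K" "K \<subseteq> T" "r i < \<rho>"
  shows "weight \<rho> K = 0"
proof -
  have "i \<in> insert 0 S" "i \<noteq> 0" using assms T_sub zero_notin_T by (blast, metis subsetD)
  moreover have "factor \<rho> K i x = 0" for x
    using assms \<open>i \<noteq> 0\<close> by (simp add: config_factor_def base_shift_def low_shift_def)
  ultimately have "(\<Prod>j\<in>insert 0 S. factor \<rho> K j x) = 0" for x
    using finite_S by (intro prod_zero) auto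
  then show ?thesis by (simp add: config_weight_def del: prod.insert)
qed

text \<open>Each tie prescribes the difference of two noise terms, and there are finitely many pairs
  of options.\<close>

lemma AE_no_ties: "AE \<omega> in M. no_ties v r T S \<rho> (noise \<omega>)"
proof -
  have "AE \<omega> in M. \<forall>i\<in>insert 0 S. \<forall>j\<in>insert 0 S. i \<noteq> j \<longrightarrow>
      \<epsilon> j \<omega> - \<epsilon> i \<omega> \<noteq> base_shift v r i - base_shift v r j \<and>
      \<epsilon> j \<omega> - \<epsilon> i \<omega> \<noteq> v i - \<rho> - base_shift v r j \<and> \<epsilon> j \<omega> - \<epsilon> i \<omega> \<noteq> v i - v j"
    using finite_S options_le
    by (intro AE_finite_allI finite.insertI AE_impI AE_conjI AE_difference_ne) auto
  then show ?thesis
  proof eventually_elim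
    case (elim \<omega>)
    show ?case
      unfolding no_ties_def
    proof (intro ballI impI)
      fix i j assume "i \<in> insert 0 S" "j \<in> insert 0 S" "i \<noteq> j"
      then have *: "\<epsilon> j \<omega> - \<epsilon> i \<omega> \<noteq> base_shift v r i - base_shift v r j"
        "\<epsilon> j \<omega> - \<epsilon> i \<omega> \<noteq> v i - \<rho> - base_shift v r j" "\<epsilon> j \<omega> - \<epsilon> i \<omega> \<noteq> v i - v j"
        using elim by blast+
      have "x \<in> T \<Longrightarrow> x \<noteq> 0" for x using zero_notin_T by metis
      with * show "utility v r (noise \<omega>) i \<noteq> utility v r (noise \<omega>) j \<and>
          (i \<in> T \<longrightarrow> valuation v (noise \<omega>) i - \<rho> \<noteq> utility v r (noise \<omega>) j \<and>
            (j \<in> T \<longrightarrow> valuation v (noise \<omega>) i \<noteq> valuation v (noise \<omega>) j))"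
        by (auto simp: utility_eq_shift valuation_def)
    qed
  qed
qed


section \<open>Measurable choice events and their probabilities\<close>

lemma measurable_utility: "i \<in> insert 0 S \<Longrightarrow> (\<lambda>\<omega>. utility v r (noise \<omega>) i) \<in> borel_measurable M"
  using measurable_noise[OF options_le] by (simp add: utility_eq_shift)

lemma measurable_valuation: "i \<in> insert 0 S \<Longrightarrow> (\<lambda>\<omega>. valuation v (noise \<omega>) i) \<in> borel_measurable M"
  using measurable_noise[OF options_le] by (cases "i = 0") (simp_all add: valuation_def)

lemma measurable_discounted:
  "i \<in> insert 0 S \<Longrightarrow> (\<lambda>\<omega>. discounted v r (noise \<omega>) \<rho> i) \<in> borel_measurable M"
  using measurable_valuation by (simp add: discounted_def)

lemma sets_configuration:
  assumes x [measurable]: "x \<in> borel_measurable M"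
  shows "{\<omega>\<in>space M. configuration v r T S \<rho> (noise \<omega>) (x \<omega>) i K} \<in> events"
  unfolding configuration_def
proof (intro sets.sets_Collect_finite_All)
  fix j assume "j \<in> insert 0 S - {i}"
  then have j: "j \<in> insert 0 S" by blast
  note [measurable] = measurable_utility[OF j] measurable_discounted[OF j]
  show "{\<omega>\<in>space M. if j \<in> K then utility v r (noise \<omega>) j < x \<omega> \<and> x \<omega> < discounted v r (noise \<omega>) \<rho> j
      else if j \<in> T then discounted v r (noise \<omega>) \<rho> j < x \<omega> else utility v r (noise \<omega>) j < x \<omega>} \<in> events"
    by (cases "j \<in> K"; cases "j \<in> T"; simp; measurable)
qed (use finite_S in simp)

lemma measurable_rank_count:
  assumes i: "i \<in> insert 0 S"
  shows "(\<lambda>\<omega>. real (card {j\<in>T. utility v r (noise \<omega>) i \<le> valuation v (noise \<omega>) j - \<rho>}))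
    \<in> borel_measurable M"
proof -
  have "real (card {j\<in>T. utility v r (noise \<omega>) i \<le> valuation v (noise \<omega>) j - \<rho>})
    = (\<Sum>j\<in>T. if utility v r (noise \<omega>) i \<le> valuation v (noise \<omega>) j - \<rho> then 1 else 0)" for \<omega>
    using finite_T by (simp add: sum.If_cases Int_def)
  moreover have "(\<lambda>\<omega>. \<Sum>j\<in>T. if utility v r (noise \<omega>) i \<le> valuation v (noise \<omega>) j - \<rho>
      then 1 else 0 :: real) \<in> borel_measurable M"
  proof (rule borel_measurable_sum)
    fix j assume "j \<in> T"
    then have j: "j \<in> insert 0 S" using T_sub by blast
    note [measurable] = measurable_utility[OF i] measurable_valuation[OF j]
    show "(\<lambda>\<omega>. if utility v r (noise \<omega>) i \<le> valuation v (noise \<omega>) j - \<rho>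
      then 1 else 0 :: real) \<in> borel_measurable M"
      by measurable
  qed
  ultimately show ?thesis by simp
qed

lemma sets_chooses:
  assumes i: "i \<in> insert 0 S"
  shows "{\<omega>\<in>space M. chooses k v r T S \<rho> (noise \<omega>) i} \<in> events"
proof -
  note [measurable] = measurable_rank_count[OF i, of \<rho>]
  have "{\<omega>\<in>space M. \<forall>j\<in>insert 0 S. utility v r (noise \<omega>) j \<le> utility v r (noise \<omega>) i} \<in> events"
  proof (intro sets.sets_Collect_finite_All)
    fix j assume j: "j \<in> insert 0 S"
    note [measurable] = measurable_utility[OF i] measurable_utility[OF j]
    show "{\<omega>\<in>space M. utility v r (noise \<omega>) j \<le> utility v r (noise \<omega>) i} \<in> events" by measurable
  qed (use finite_S in simp)
  moreover have "{\<omega>\<in>space M. real (card {j\<in>T. utility v r (noise \<omega>) i \<le> valuation v (noise \<omega>) j - \<rho>})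
      < real m} \<in> events"
    by measurable
  ultimately have "{\<omega>\<in>space M. \<forall>j\<in>insert 0 S. utility v r (noise \<omega>) j \<le> utility v r (noise \<omega>) i}
    \<inter> {\<omega>\<in>space M. real (card {j\<in>T. utility v r (noise \<omega>) i \<le> valuation v (noise \<omega>) j - \<rho>})
      < real m} \<in> events"
    by (rule sets.Int)
  moreover have "{\<omega>\<in>space M. chooses k v r T S \<rho> (noise \<omega>) i} =
    {\<omega>\<in>space M. \<forall>j\<in>insert 0 S. utility v r (noise \<omega>) j \<le> utility v r (noise \<omega>) i}
    \<inter> {\<omega>\<in>space M. real (card {j\<in>T. utility v r (noise \<omega>) i \<le> valuation v (noise \<omega>) j - \<rho>})
      < real m}"
    unfolding of_nat_less_iff using i by (simp only: chooses_iff[OF finite_T k_pos]) blast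
  ultimately show ?thesis by (simp only:)
qed

lemma sets_chooses_opaque: "{\<omega>\<in>space M. chooses_opaque k v r T S \<rho> (noise \<omega>)} \<in> events"
  unfolding chooses_opaque_iff[OF finite_T k_pos]
proof (intro sets.sets_Collect_finite_All)
  fix i assume i: "i \<in> insert 0 S"
  note [measurable] = measurable_rank_count[OF i, of \<rho>]
  have "{\<omega>\<in>space M. real m \<le> real (card {j\<in>T. utility v r (noise \<omega>) i \<le> valuation v (noise \<omega>) j - \<rho>})} \<in> events"
    by measurable
  then show "{\<omega>\<in>space M. m \<le> card {j\<in>T. utility v r (noise \<omega>) i \<le> valuation v (noise \<omega>) j - \<rho>}} \<in> events"
    by (simp only: of_nat_le_iff)
qed (use finite_S in simp)

text \<open>Up to ties, the event that \<open>i\<close> is chosen is the disjoint union of its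
  configurations over the admissible sets \<open>K\<close>.\<close>

lemma choice_prob_eq:
  assumes i: "i \<in> insert 0 S"
  shows "choice_prob M \<epsilon> k v r T S \<rho> i = exp (base_shift v r i) *
    (\<Sum>K | K \<subseteq> T - {i} \<and> card K + of_bool (i \<in> T \<and> \<rho> \<le> r i) < m.
       weight \<rho> K + (if i \<in> T then weight \<rho> (insert i K) else 0))"
proof -
  let ?C = "{K. K \<subseteq> T - {i} \<and> card K + of_bool (i \<in> T \<and> \<rho> \<le> r i) < m}"
  let ?E = "\<lambda>K. {\<omega>\<in>space M. configuration v r T S \<rho> (noise \<omega>) (utility v r (noise \<omega>) i) i K}"
  have fin: "finite ?C" using finite_T by (intro finite_subset[of ?C "Pow T"]) auto
  have sets: "?E K \<in> events" for K
    using measurable_utility[OF i] by (rule sets_configuration)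
  have AE: "AE \<omega> in M. \<omega> \<in> {\<omega>\<in>space M. chooses k v r T S \<rho> (noise \<omega>) i} \<longleftrightarrow> \<omega> \<in> (\<Union>K\<in>?C. ?E K)"
    using AE_no_ties[of \<rho>] AE_space
  proof eventually_elim
    case (elim \<omega>)
    show ?case
      using chooses_iff_configuration[OF finite_T k_pos T_sub zero_notin_S elim(1) i] elim(2) by auto
  qed
  have "choice_prob M \<epsilon> k v r T S \<rho> i = prob (\<Union>K\<in>?C. ?E K)"
    unfolding choice_prob_def
    by (rule measure_eq_AE[OF AE sets_chooses[OF i] sets.finite_UN[OF fin sets]])
  also have "\<dots> = (\<Sum>K\<in>?C. prob (?E K))"
  proof (rule finite_measure_finite_Union[OF fin])
    show "disjoint_family_on ?E ?C"
      unfolding disjoint_family_on_def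
    proof (intro ballI impI equals0I)
      fix K K' \<omega> assume K: "K \<in> ?C" "K' \<in> ?C" "K \<noteq> K'" and "\<omega> \<in> ?E K \<inter> ?E K'"
      then have "configuration v r T S \<rho> (noise \<omega>) (utility v r (noise \<omega>) i) i K"
        "configuration v r T S \<rho> (noise \<omega>) (utility v r (noise \<omega>) i) i K'"
        by simp_all
      moreover have "K \<subseteq> T - {i}" "K' \<subseteq> T - {i}" using K by simp_all
      ultimately have "K = K'"
        using configuration_unique[OF T_sub] by (metis (no_types, lifting))
      with K(3) show False by simp
    qed
  qed (use sets in blast)
  also have "\<dots> = (\<Sum>K\<in>?C. exp (base_shift v r i) *
      (weight \<rho> K + (if i \<in> T then weight \<rho> (insert i K) else 0)))"
    using i by (intro sum.cong refl prob_full_price_configuration) auto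
  finally show ?thesis by (simp only: sum_distrib_left)
qed

text \<open>The union runs over pairs of the product that realises the opaque valuation and the set
  ranked above it. All these sets have the same cardinality, so
  \<open>configuration_rank_unique\<close> makes the pairs disjoint.\<close>

lemma opaque_choice_prob_eq:
  "opaque_choice_prob M \<epsilon> k v r T S \<rho> =
    (\<Sum>i\<in>{i\<in>T. \<rho> \<le> r i}. exp (low_shift v r \<rho> i) * (\<Sum>K | K \<subseteq> T - {i} \<and> card K + 1 = m. weight \<rho> K))"
proof -
  let ?C = "\<lambda>i. {K. K \<subseteq> T - {i} \<and> card K + 1 = m}"
  let ?E = "\<lambda>(i, K). {\<omega>\<in>space M. configuration v r T S \<rho> (noise \<omega>) (discounted v r (noise \<omega>) \<rho> i) i K}"
  let ?I = "SIGMA i : {i\<in>T. \<rho> \<le> r i}. ?C i"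
  have finC: "finite (?C i)" for i using finite_T by (intro finite_subset[of "?C i" "Pow T"]) auto
  then have fin: "finite ?I" using finite_T by auto
  have sets: "?E p \<in> events" if "p \<in> ?I" for p
  proof -
    obtain i K where p: "p = (i, K)" by (cases p)
    then have "i \<in> insert 0 S" using that T_sub by blast
    then show ?thesis unfolding p by (auto intro: sets_configuration measurable_discounted)
  qed
  have AE: "AE \<omega> in M. \<omega> \<in> {\<omega>\<in>space M. chooses_opaque k v r T S \<rho> (noise \<omega>)} \<longleftrightarrow> \<omega> \<in> (\<Union>p\<in>?I. ?E p)"
    using AE_no_ties[of \<rho>] AE_space
  proof eventually_elim
    case (elim \<omega>)
    show ?case
      using chooses_opaque_iff_configuration[OF finite_T k_pos T_sub zero_notin_S elim(1)] elim(2) by auto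
  qed
  have "opaque_choice_prob M \<epsilon> k v r T S \<rho> = prob (\<Union>p\<in>?I. ?E p)"
    unfolding opaque_choice_prob_def
    by (rule measure_eq_AE[OF AE sets_chooses_opaque sets.finite_UN[OF fin sets]])
  also have "\<dots> = (\<Sum>p\<in>?I. prob (?E p))"
  proof (rule finite_measure_finite_Union[OF fin])
    show "disjoint_family_on ?E ?I"
      unfolding disjoint_family_on_def
    proof (intro ballI impI)
      fix p p' assume p: "p \<in> ?I" "p' \<in> ?I" "p \<noteq> p'"
      obtain i K i' K' where eq: "p = (i, K)" "p' = (i', K')" by (cases p; cases p')
      have iK: "i \<in> T" "K \<subseteq> T - {i}" "i' \<in> T" "K' \<subseteq> T - {i'}" "card K = card K'"
        using p eq by auto
      show "?E p \<inter> ?E p' = {}"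
      proof (rule equals0I)
        fix \<omega> assume "\<omega> \<in> ?E p \<inter> ?E p'"
        then have c: "configuration v r T S \<rho> (noise \<omega>) (discounted v r (noise \<omega>) \<rho> i) i K"
          "configuration v r T S \<rho> (noise \<omega>) (discounted v r (noise \<omega>) \<rho> i') i' K'"
          by (simp_all add: eq)
        have "i = i'"
          by (rule configuration_rank_unique[OF finite_T T_sub zero_notin_S iK(1,2) c(1) iK(3,4) c(2) iK(5)])
        moreover have "K = K'"
          using configuration_unique[OF T_sub iK(2) c(1)] configuration_unique[OF T_sub iK(4) c(2)]
          unfolding \<open>i = i'\<close> by (rule trans[OF _ sym])
        ultimately show False using p(3) eq by simp
      qed
    qed
  qed (use sets in blast)
  also have "\<dots> = (\<Sum>i\<in>{i\<in>T. \<rho> \<le> r i}. \<Sum>K\<in>?C i. prob (?E (i, K)))"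
    using finite_T finC by (subst sum.Sigma) (auto simp: split_def)
  also have "\<dots> = (\<Sum>i\<in>{i\<in>T. \<rho> \<le> r i}. \<Sum>K\<in>?C i. exp (low_shift v r \<rho> i) * weight \<rho> K)"
    unfolding prod.case by (intro sum.cong refl prob_low_price_configuration) auto
  finally show ?thesis by (simp only: sum_distrib_left)
qed

text \<open>Outside the null event of ties exactly one option is chosen: the opaque product, or else
  the unique option of largest utility. Integrating the sum of indicators gives the claim.\<close>

lemma choice_prob_sum_eq_1:
  "(\<Sum>i\<in>insert 0 S. choice_prob M \<epsilon> k v r T S \<rho> i) + opaque_choice_prob M \<epsilon> k v r T S \<rho> = 1"
proof -
  let ?E = "\<lambda>i. {\<omega>\<in>space M. chooses k v r T S \<rho> (noise \<omega>) i}"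
  let ?Q = "{\<omega>\<in>space M. chooses_opaque k v r T S \<rho> (noise \<omega>)}"
  have fin: "finite (insert 0 S)" using finite_S by simp
  have one: "(\<Sum>i\<in>insert 0 S. indicator (?E i) \<omega>) + indicator ?Q \<omega> = (1::real)"
    if nt: "no_ties v r T S \<rho> (noise \<omega>)" and \<omega>: "\<omega> \<in> space M" for \<omega>
  proof (cases "chooses_opaque k v r T S \<rho> (noise \<omega>)")
    case True
    then have "\<not> chooses k v r T S \<rho> (noise \<omega>) i" for i
      unfolding chooses_opaque_def chooses_def by (metis not_le)
    then show ?thesis using True \<omega> by simp
  next
    case False
    then obtain j where j: "j \<in> insert 0 S" "opaque_utility k v T \<rho> (noise \<omega>) < ereal (utility v r (noise \<omega>) j)"
      unfolding chooses_opaque_def by (metis not_le)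
    let ?u = "utility v r (noise \<omega>)"
    obtain i where i: "i \<in> insert 0 S" "?u i = Max (?u ` insert 0 S)"
      using Max_in[of "?u ` insert 0 S"] fin by fastforce
    have imax: "?u l \<le> ?u i" if "l \<in> insert 0 S" for l
      unfolding i(2) using that fin by (intro Max_ge finite_imageI imageI)
    have "opaque_utility k v T \<rho> (noise \<omega>) < ereal (?u i)"
      using j(2) imax[OF j(1)] by (metis ereal_less_eq(3) order_less_le_trans)
    then have ci: "chooses k v r T S \<rho> (noise \<omega>) i"
      using i(1) imax by (simp add: chooses_def)
    have "chooses k v r T S \<rho> (noise \<omega>) l \<longleftrightarrow> l = i" if l: "l \<in> insert 0 S" for l
    proof
      assume "chooses k v r T S \<rho> (noise \<omega>) l"
      then have "?u l = ?u i" using imax[OF l] i(1) unfolding chooses_def by (metis order_antisym)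
      then show "l = i" using nt l i(1) unfolding no_ties_def by metis
    qed (use ci in simp)
    then have "(\<Sum>l\<in>insert 0 S. indicator (?E l) \<omega>) = (\<Sum>l\<in>insert 0 S. if l = i then 1 else 0 :: real)"
      using \<omega> by (intro sum.cong refl) (simp add: indicator_def)
    also have "\<dots> = 1" using i(1) fin by (simp only: sum.delta if_True)
    finally show ?thesis using False by simp
  qed
  have "AE \<omega> in M. (\<Sum>i\<in>insert 0 S. indicator (?E i) \<omega>) + indicator ?Q \<omega> = (1::real)"
    using AE_no_ties[of \<rho>] AE_space by eventually_elim (rule one)
  then have "(\<integral>\<omega>. (\<Sum>i\<in>insert 0 S. indicator (?E i) \<omega>) + indicator ?Q \<omega> \<partial>M) = (\<integral>\<omega>. (1::real) \<partial>M)"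
    using sets_chooses sets_chooses_opaque
    by (intro integral_cong_AE borel_measurable_add borel_measurable_sum borel_measurable_indicator
        borel_measurable_const) auto
  moreover have "(\<integral>\<omega>. (\<Sum>i\<in>insert 0 S. indicator (?E i) \<omega>) + indicator ?Q \<omega> \<partial>M)
    = (\<Sum>i\<in>insert 0 S. prob (?E i)) + prob ?Q"
  proof -
    have 1: "integrable M (indicator (?E i) :: _ \<Rightarrow> real)" if "i \<in> insert 0 S" for i
      using sets_chooses[OF that] by (intro integrable_real_indicator) (auto simp: emeasure_eq_measure)
    have 2: "integrable M (indicator ?Q :: _ \<Rightarrow> real)"
      using sets_chooses_opaque by (intro integrable_real_indicator) (auto simp: emeasure_eq_measure)
    have "(\<integral>\<omega>. indicator (?E i) \<omega> \<partial>M) = prob (?E i)" if "i \<in> insert 0 S" for i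
      using sets_chooses[OF that] by (simp add: Int_absorb2 sets.sets_into_space)
    moreover have "(\<integral>\<omega>. indicator ?Q \<omega> \<partial>M) = prob ?Q"
      using sets_chooses_opaque by (simp add: Int_absorb2 sets.sets_into_space)
    ultimately show ?thesis
      by (simp only: Bochner_Integration.integral_add[OF Bochner_Integration.integrable_sum[OF 1] 2]
          Bochner_Integration.integral_sum[OF 1] cong: sum.cong)
  qed
  ultimately show ?thesis
    by (simp only: choice_prob_def opaque_choice_prob_def) (simp add: prob_space)
qed

end

section \<open>Revenue and optimal assortments\<close>

text \<open>Up to normalisation, the excess over \<open>R\<close> of the revenue of the plain MNL model in which
  the products of \<open>U\<close> cost \<open>min (r i) \<rho>\<close> and those of \<open>S - U\<close> cost \<open>r i\<close>.\<close>

definition surplus :: "(nat \<Rightarrow> real) \<Rightarrow> (nat \<Rightarrow> real) \<Rightarrow> nat set \<Rightarrow> nat set \<Rightarrow> real \<Rightarrow> real \<Rightarrow> real" where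
  "surplus v r S U \<rho> R =
     (\<Sum>i\<in>S. if i \<in> U then exp (low_shift v r \<rho> i) * (min (r i) \<rho> - R)
        else exp (base_shift v r i) * (r i - R)) - R"

text \<open>Pairs each subset avoiding \<open>i\<close> with the one obtained by adding
  \<open>i\<close>.\<close>

lemma sum_Pow_insert:
  fixes f :: "'b set \<Rightarrow> 'c::comm_monoid_add"
  assumes "finite A" "i \<in> A"
  shows "(\<Sum>K\<in>Pow A. f K) = (\<Sum>K\<in>Pow (A - {i}). f K + f (insert i K))"
proof -
  have "Pow A = Pow (insert i (A - {i}))" using assms(2) by (simp add: insert_absorb)
  also have "\<dots> = Pow (A - {i}) \<union> insert i ` Pow (A - {i})" by (rule Pow_insert)
  finally have "(\<Sum>K\<in>Pow A. f K) = (\<Sum>K\<in>Pow (A - {i}). f K) + (\<Sum>K\<in>insert i ` Pow (A - {i}). f K)"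
    using assms(1) by (subst sum.union_disjoint[symmetric]) auto
  also have "(\<Sum>K\<in>insert i ` Pow (A - {i}). f K) = (\<Sum>K\<in>Pow (A - {i}). f (insert i K))"
    by (subst sum.reindex) (auto simp: inj_on_def)
  finally show ?thesis by (simp only: sum.distrib)
qed

lemma continuous_on_low_shift: "continuous_on A (\<lambda>\<rho>. low_shift v r \<rho> i)"
  unfolding low_shift_def by (intro continuous_intros)

lemma continuous_on_surplus: "continuous_on A (\<lambda>\<rho>. surplus v r S U \<rho> R)"
proof -
  have "continuous_on A (\<lambda>\<rho>. if i \<in> U then exp (low_shift v r \<rho> i) * (min (r i) \<rho> - R)
        else exp (base_shift v r i) * (r i - R))" for i
    by (cases "i \<in> U"; simp; intro continuous_intros continuous_on_low_shift)
  then show ?thesis unfolding surplus_def by (intro continuous_intros) auto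
qed

section \<open>The opaque revenue as a mixture of MNL revenues\<close>

context opaque_offer
begin

text \<open>Here \<open>\<alpha>\<close> is the payoff of buying \<open>i\<close> itself and
  \<open>\<beta>\<close> that of buying the opaque product. Reindexing by subsets of
  \<open>T\<close> makes the weights independent of \<open>i\<close>. If
  \<open>\<rho> \<le> r i\<close>, full-price purchases miss exactly the sets of
  \<open>m - 1\<close> elements avoiding \<open>i\<close>, and opaque purchases realised at
  \<open>i\<close> supply them.\<close>

lemma payoff_at_option:
  assumes i: "i \<in> insert 0 S"
  shows "\<alpha> * choice_prob M \<epsilon> k v r T S \<rho> i +
      (if i \<in> T \<and> \<rho> \<le> r i then \<beta> * (exp (low_shift v r \<rho> i) *
         (\<Sum>K | K \<subseteq> T - {i} \<and> card K + 1 = m. weight \<rho> K)) else 0)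
    = (\<Sum>K | K \<subseteq> T \<and> card K < m. weight \<rho> K *
        (if i \<in> T - K \<and> card K + 1 = m then exp (low_shift v r \<rho> i) * (if \<rho> \<le> r i then \<beta> else \<alpha>)
         else exp (base_shift v r i) * \<alpha>))"
proof (cases "i \<in> T")
  case False
  then have "T - {i} = T" by simp
  then show ?thesis using False
    by (simp add: choice_prob_eq[OF i] sum_distrib_left mult_ac)
next
  case True
  have i0: "i \<noteq> 0" using True zero_notin_T by metis
  let ?s = "exp (base_shift v r i)" and ?t = "exp (low_shift v r \<rho> i)" and ?b = "of_bool (\<rho> \<le> r i) :: nat"
  let ?g = "\<lambda>K. if i \<in> T - K \<and> card K + 1 = m then ?t * (if \<rho> \<le> r i then \<beta> else \<alpha>) else ?s * \<alpha>"
  have fin: "finite (Pow (T - {i}))" "finite (Pow T)" using finite_T by auto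
  have filter: "(\<Sum>K | K \<subseteq> A \<and> P K. f K) = (\<Sum>K\<in>Pow A. if P K then f K else 0)"
    if "finite A" for A :: "nat set" and P and f :: "nat set \<Rightarrow> real"
  proof -
    have "{K. K \<subseteq> A \<and> P K} = {K\<in>Pow A. P K}" by blast
    then show ?thesis using sum.inter_filter[of "Pow A" f P] that by (simp only: finite_Pow_iff simp_thms)
  qed
  have "(\<Sum>K | K \<subseteq> T \<and> card K < m. weight \<rho> K * ?g K)
    = (\<Sum>K\<in>Pow (T - {i}). (if card K < m then weight \<rho> K * ?g K else 0)
        + (if card (insert i K) < m then weight \<rho> (insert i K) * ?g (insert i K) else 0))"
    by (simp only: filter[OF finite_T] sum_Pow_insert[OF finite_T True])
  also have "\<dots> = (\<Sum>K\<in>Pow (T - {i}).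
      \<alpha> * (?s * (if card K + ?b < m then weight \<rho> K + weight \<rho> (insert i K) else 0))
      + (if \<rho> \<le> r i then \<beta> * (?t * (if card K + 1 = m then weight \<rho> K else 0)) else 0))"
  proof (intro sum.cong refl)
    fix K assume K: "K \<in> Pow (T - {i})"
    then have iK: "i \<notin> K" and "finite K" using finite_T by (auto intro: finite_subset)
    then have card: "card (insert i K) = card K + 1" by simp
    show "(if card K < m then weight \<rho> K * ?g K else 0)
        + (if card (insert i K) < m then weight \<rho> (insert i K) * ?g (insert i K) else 0)
      = \<alpha> * (?s * (if card K + ?b < m then weight \<rho> K + weight \<rho> (insert i K) else 0))
      + (if \<rho> \<le> r i then \<beta> * (?t * (if card K + 1 = m then weight \<rho> K else 0)) else 0)"
    proof (cases "\<rho> \<le> r i")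
      case le: True
      \<comment> \<open>Either both \<open>K\<close> and \<open>insert i K\<close> are below the
        bound, or only \<open>K\<close> is and its weight comes from the opaque product, or neither
        counts.\<close>
      consider "card K + 1 < m" | "card K + 1 = m" | "m < card K + 1" by linarith
      then show ?thesis
        using le iK True card by cases (simp_all add: algebra_simps)
    next
      case False
      \<comment> \<open>Without a discount on \<open>i\<close>, the sets containing \<open>i\<close>
        have weight 0 and both shifts of \<open>i\<close> agree, so the full-price sum alone gives
        the right side.\<close>
      then have "weight \<rho> (insert i K) = 0"
        using K True by (intro weight_eq_0[of i]) auto
      moreover have "?t = ?s" using False i0 by (simp add: low_shift_def base_shift_def)
      ultimately show ?thesis using False iK True by (simp add: algebra_simps)
    qed
  qed
  also have "\<dots> = \<alpha> * (?s * (\<Sum>K\<in>Pow (T - {i}). if card K + ?b < m then weight \<rho> K + weight \<rho> (insert i K) else 0))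
      + (if \<rho> \<le> r i then \<beta> * (?t * (\<Sum>K\<in>Pow (T - {i}). if card K + 1 = m then weight \<rho> K else 0)) else 0)"
    by (simp add: sum.distrib sum_distrib_left)
  finally show ?thesis
    using True finite_T by (simp add: choice_prob_eq[OF i] filter)
qed

text \<open>Arbitrary payoffs allow two uses: net of \<open>R\<close> they give the revenue, and
  constantly 1 they give the total mass.\<close>

lemma expected_payoff_eq:
  "(\<Sum>i\<in>insert 0 S. \<alpha> i * choice_prob M \<epsilon> k v r T S \<rho> i) + \<beta> * opaque_choice_prob M \<epsilon> k v r T S \<rho>
    = (\<Sum>K | K \<subseteq> T \<and> card K < m. weight \<rho> K *
        (\<Sum>i\<in>insert 0 S. if i \<in> T - K \<and> card K + 1 = m
           then exp (low_shift v r \<rho> i) * (if \<rho> \<le> r i then \<beta> else \<alpha> i)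
           else exp (base_shift v r i) * \<alpha> i))"
proof -
  let ?q = "\<lambda>i. \<beta> * (exp (low_shift v r \<rho> i) *
         (\<Sum>K | K \<subseteq> T - {i} \<and> card K + 1 = m. weight \<rho> K))"
  have "{i\<in>T. \<rho> \<le> r i} = {i\<in>insert 0 S. i \<in> T \<and> \<rho> \<le> r i}" using T_sub by auto
  moreover have "\<beta> * opaque_choice_prob M \<epsilon> k v r T S \<rho> = (\<Sum>i\<in>{i\<in>T. \<rho> \<le> r i}. ?q i)"
    by (simp only: opaque_choice_prob_eq sum_distrib_left)
  moreover have "finite (insert 0 S)" using finite_S by simp
  ultimately have "\<beta> * opaque_choice_prob M \<epsilon> k v r T S \<rho>
      = (\<Sum>i\<in>insert 0 S. if i \<in> T \<and> \<rho> \<le> r i then ?q i else 0)"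
    by (simp only: sum.inter_filter)
  then have "(\<Sum>i\<in>insert 0 S. \<alpha> i * choice_prob M \<epsilon> k v r T S \<rho> i)
      + \<beta> * opaque_choice_prob M \<epsilon> k v r T S \<rho>
    = (\<Sum>i\<in>insert 0 S. \<alpha> i * choice_prob M \<epsilon> k v r T S \<rho> i
        + (if i \<in> T \<and> \<rho> \<le> r i then ?q i else 0))"
    by (simp only: sum.distrib)
  also have "\<dots> = (\<Sum>i\<in>insert 0 S. \<Sum>K | K \<subseteq> T \<and> card K < m. weight \<rho> K *
        (if i \<in> T - K \<and> card K + 1 = m then exp (low_shift v r \<rho> i) * (if \<rho> \<le> r i then \<beta> else \<alpha> i)
         else exp (base_shift v r i) * \<alpha> i))"
    by (intro sum.cong refl payoff_at_option)
  also have "\<dots> = (\<Sum>K | K \<subseteq> T \<and> card K < m. \<Sum>i\<in>insert 0 S. weight \<rho> K *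
        (if i \<in> T - K \<and> card K + 1 = m then exp (low_shift v r \<rho> i) * (if \<rho> \<le> r i then \<beta> else \<alpha> i)
         else exp (base_shift v r i) * \<alpha> i))"
    by (rule sum.swap)
  finally show ?thesis by (simp only: sum_distrib_left)
qed

text \<open>Since the choice probabilities add up to 1, subtracting \<open>R\<close> from the
  revenue is charging \<open>R\<close> to every outcome. The charge on no purchase is the final
  \<open>- R\<close> in \<open>surplus\<close>.\<close>

lemma Rev_minus_eq:
  "Rev M \<epsilon> k v r T S \<rho> - R = (\<Sum>K | K \<subseteq> T \<and> card K < m.
     weight \<rho> K * surplus v r S (if card K + 1 = m then T - K else {}) \<rho> R)"
proof -
  let ?\<alpha> = "\<lambda>i. (if i = 0 then 0 else r i) - R"
  let ?\<pi> = "choice_prob M \<epsilon> k v r T S \<rho>" and ?q = "opaque_choice_prob M \<epsilon> k v r T S \<rho>"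
  have S0: "(\<Sum>i\<in>insert 0 S. f i) = f 0 + (\<Sum>i\<in>S. f i)" for f :: "nat \<Rightarrow> real"
    using finite_S zero_notin_S by simp
  have ne: "i \<noteq> 0" if "i \<in> S" for i using that zero_notin_S by metis
  have "(\<Sum>i\<in>insert 0 S. (if i = 0 then 0 else r i) * ?\<pi> i) = (\<Sum>i\<in>S. r i * ?\<pi> i)"
  proof -
    have "(\<Sum>i\<in>S. (if i = 0 then 0 else r i) * ?\<pi> i) = (\<Sum>i\<in>S. r i * ?\<pi> i)"
      by (intro sum.cong refl) (simp only: ne if_False)
    then show ?thesis unfolding S0 by simp
  qed
  moreover have "(\<Sum>i\<in>insert 0 S. ?\<alpha> i * ?\<pi> i)
    = (\<Sum>i\<in>insert 0 S. (if i = 0 then 0 else r i) * ?\<pi> i) - R * (\<Sum>i\<in>insert 0 S. ?\<pi> i)"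
    by (simp only: left_diff_distrib sum_subtractf sum_distrib_left)
  ultimately have "(\<Sum>i\<in>insert 0 S. ?\<alpha> i * ?\<pi> i) + (\<rho> - R) * ?q
    = Rev M \<epsilon> k v r T S \<rho> - R * ((\<Sum>i\<in>insert 0 S. ?\<pi> i) + ?q)"
    by (simp only: Rev_def) (simp add: algebra_simps)
  then have "Rev M \<epsilon> k v r T S \<rho> - R = (\<Sum>i\<in>insert 0 S. ?\<alpha> i * ?\<pi> i) + (\<rho> - R) * ?q"
    by (simp only: choice_prob_sum_eq_1 mult_1_right)
  also have "\<dots> = (\<Sum>K | K \<subseteq> T \<and> card K < m. weight \<rho> K *
        (\<Sum>i\<in>insert 0 S. if i \<in> T - K \<and> card K + 1 = m
           then exp (low_shift v r \<rho> i) * (if \<rho> \<le> r i then \<rho> - R else ?\<alpha> i)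
           else exp (base_shift v r i) * ?\<alpha> i))"
    by (rule expected_payoff_eq)
  also have "\<dots> = (\<Sum>K | K \<subseteq> T \<and> card K < m.
     weight \<rho> K * surplus v r S (if card K + 1 = m then T - K else {}) \<rho> R)"
  proof (intro sum.cong refl arg_cong2[of _ _ _ _ "(*)"])
    fix K
    have "(\<Sum>i\<in>S. if i \<in> T - K \<and> card K + 1 = m
           then exp (low_shift v r \<rho> i) * (if \<rho> \<le> r i then \<rho> - R else ?\<alpha> i)
           else exp (base_shift v r i) * ?\<alpha> i)
      = (\<Sum>i\<in>S. if i \<in> (if card K + 1 = m then T - K else {})
           then exp (low_shift v r \<rho> i) * (min (r i) \<rho> - R)
           else exp (base_shift v r i) * (r i - R))"
    proof (intro sum.cong refl)
      fix i assume "i \<in> S"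
      from ne[OF this] show "(if i \<in> T - K \<and> card K + 1 = m
           then exp (low_shift v r \<rho> i) * (if \<rho> \<le> r i then \<rho> - R else ?\<alpha> i)
           else exp (base_shift v r i) * ?\<alpha> i)
        = (if i \<in> (if card K + 1 = m then T - K else {})
           then exp (low_shift v r \<rho> i) * (min (r i) \<rho> - R)
           else exp (base_shift v r i) * (r i - R))"
        by (cases "\<rho> \<le> r i") (auto simp: min_def)
    qed
    then show "(\<Sum>i\<in>insert 0 S. if i \<in> T - K \<and> card K + 1 = m
           then exp (low_shift v r \<rho> i) * (if \<rho> \<le> r i then \<rho> - R else ?\<alpha> i)
           else exp (base_shift v r i) * ?\<alpha> i)
      = surplus v r S (if card K + 1 = m then T - K else {}) \<rho> R"
      unfolding S0 surplus_def using zero_notin_T by (simp add: base_shift_def)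
  qed
  finally show ?thesis .
qed

text \<open>With all payoffs equal to 1 the expected payoff is 1, so the weights cannot all
  vanish.\<close>

lemma exists_weight_pos: "\<exists>K\<subseteq>T. card K < m \<and> 0 < weight \<rho> K"
proof (rule ccontr)
  assume "\<not> ?thesis"
  then have "weight \<rho> K = 0" if "K \<subseteq> T" "card K < m" for K
    using that weight_nonneg[OF that(1), of \<rho>] by force
  then have "(\<Sum>i\<in>insert 0 S. 1 * choice_prob M \<epsilon> k v r T S \<rho> i) + 1 * opaque_choice_prob M \<epsilon> k v r T S \<rho> = 0"
    unfolding expected_payoff_eq by (intro sum.neutral) auto
  then show False using choice_prob_sum_eq_1[of \<rho>] by (simp only: mult_1_left)
qed

text \<open>For such small supports the rank from the top is 1, so the mixture has the single
  component \<open>K = {}\<close>. The sign of the surplus is then that of the excess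
  revenue.\<close>

lemma Rev_minus_eq_small:
  assumes "card T \<le> k"
  shows "0 < weight \<rho> {}" "Rev M \<epsilon> k v r T S \<rho> - R = weight \<rho> {} * surplus v r S T \<rho> R"
proof -
  have m: "m = 1" using assms by (auto simp: rank_from_top_def)
  have C: "{K. K \<subseteq> T \<and> card K < m} = {{}}"
    using finite_subset[OF _ finite_T] by (auto simp: m)
  obtain K where "K \<in> {K. K \<subseteq> T \<and> card K < m}" "0 < weight \<rho> K"
    using exists_weight_pos[of \<rho>] by blast
  then show "0 < weight \<rho> {}" unfolding C by simp
  show "Rev M \<epsilon> k v r T S \<rho> - R = weight \<rho> {} * surplus v r S T \<rho> R"
    unfolding Rev_minus_eq C by (simp add: m)
qed

text \<open>Nonnegative weights, one of them positive, cannot produce an excess of at least 0 from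
  components that are all negative. Each component discounts at most \<open>k\<close>
  products.\<close>

lemma exists_small_support:
  assumes "R \<le> Rev M \<epsilon> k v r T S \<rho>"
  shows "\<exists>U\<subseteq>T. card U \<le> k \<and> 0 \<le> surplus v r S U \<rho> R"
proof (rule ccontr)
  assume neg: "\<not> ?thesis"
  let ?U = "\<lambda>K. if card K + 1 = m then T - K else {}"
  have lt: "surplus v r S (?U K) \<rho> R < 0" if K: "K \<subseteq> T" "card K < m" for K
  proof -
    have "finite K" using K(1) finite_T finite_subset by blast
    then have "card (T - K) = card T - card K" using K(1) by (simp add: card_Diff_subset)
    \<comment> \<open>If \<open>k \<le> card T\<close>, removing \<open>m - 1 = card T - k\<close>
      products from \<open>T\<close> leaves exactly \<open>k\<close>; otherwise \<open>T\<close>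
      itself has fewer than \<open>k\<close>.\<close>
    then have "card (?U K) \<le> k" by (auto simp: rank_from_top_def split: if_splits)
    moreover have "?U K \<subseteq> T" by auto
    ultimately show ?thesis using neg by (meson not_le)
  qed
  let ?C = "{K. K \<subseteq> T \<and> card K < m}"
  have fin: "finite ?C" using finite_T by (intro finite_subset[of ?C "Pow T"]) auto
  obtain L where L: "L \<in> ?C" "0 < weight \<rho> L" using exists_weight_pos[of \<rho>] by blast
  have "(\<Sum>K\<in>?C. weight \<rho> K * surplus v r S (?U K) \<rho> R) < (\<Sum>K\<in>?C. 0)"
  proof (rule sum_strict_mono_ex1[OF fin])
    show "\<forall>K\<in>?C. weight \<rho> K * surplus v r S (?U K) \<rho> R \<le> 0"
    proof
      fix K assume K: "K \<in> ?C"
      then have "0 \<le> weight \<rho> K" using weight_nonneg by blast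
      moreover have "surplus v r S (?U K) \<rho> R \<le> 0" using lt[of K] K by (simp only: mem_Collect_eq less_imp_le)
      ultimately show "weight \<rho> K * surplus v r S (?U K) \<rho> R \<le> 0" by (rule mult_nonneg_nonpos)
    qed
    show "\<exists>K\<in>?C. weight \<rho> K * surplus v r S (?U K) \<rho> R < 0"
    proof
      show "weight \<rho> L * surplus v r S (?U L) \<rho> R < 0"
        using L lt[of L] by (intro mult_pos_neg) (simp_all only: mem_Collect_eq)
    qed (rule L(1))
  qed
  then show False using assms Rev_minus_eq[of \<rho> R] by simp
qed

section \<open>Continuity in the opaque price and attained maxima\<close>

lemma continuous_on_weight:
  assumes "K \<subseteq> T"
  shows "continuous_on A (\<lambda>\<rho>. weight \<rho> K)"
proof (rule continuous_on_sequentiallyI)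
  fix u :: "nat \<Rightarrow> real" and \<rho> assume u: "u \<longlonglongrightarrow> \<rho>"
  let ?f = "\<lambda>\<rho> x. exp (- x) * (\<Prod>j\<in>insert 0 S. factor \<rho> K j x)"
  show "(\<lambda>n. weight (u n) K) \<longlonglongrightarrow> weight \<rho> K"
    unfolding config_weight_def
  \<comment> \<open>The dominating function is the Gumbel density, which does not involve the
    price.\<close>
  proof (rule integral_dominated_convergence)
    show "integrable lborel std_gumbel_density"
      by (rule integrable_gumbel_density[OF prob_space_gumbel])
    show "?f \<rho> \<in> borel_measurable lborel" "?f (u n) \<in> borel_measurable lborel" for n
      by measurable
    have "(\<lambda>n. low_shift v r (u n) j) \<longlonglongrightarrow> low_shift v r \<rho> j" for j
      unfolding low_shift_def using u by (intro tendsto_intros)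
    then have low: "(\<lambda>n. gumbel_cdf (x - low_shift v r (u n) j)) \<longlonglongrightarrow> gumbel_cdf (x - low_shift v r \<rho> j)" for x j
      unfolding gumbel_cdf_def by (intro tendsto_intros)
    have "(\<lambda>n. factor (u n) K j x) \<longlonglongrightarrow> factor \<rho> K j x" for j x
      unfolding config_factor_def using low by (auto intro!: tendsto_intros)
    then have "(\<lambda>n. ?f (u n) x) \<longlonglongrightarrow> ?f \<rho> x" for x
      by (intro tendsto_mult tendsto_const tendsto_prod)
    then show "AE x in lborel. (\<lambda>n. ?f (u n) x) \<longlonglongrightarrow> ?f \<rho> x" by (rule AE_I2)
    show "AE x in lborel. norm (?f (u n) x) \<le> std_gumbel_density x" for n
    proof (rule AE_I2)
      fix x
      note b = integrand_bounds[OF assms, of x "u n"]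
      show "norm (?f (u n) x) \<le> std_gumbel_density x"
        by (simp only: real_norm_def abs_of_nonneg[OF b(1)] b(2))
    qed
  qed
qed

lemma continuous_on_Rev: "continuous_on A (\<lambda>\<rho>. Rev M \<epsilon> k v r T S \<rho>)"
proof -
  have "continuous_on A (\<lambda>\<rho>. \<Sum>K | K \<subseteq> T \<and> card K < m.
     weight \<rho> K * surplus v r S (if card K + 1 = m then T - K else {}) \<rho> 0)"
    by (intro continuous_on_sum continuous_on_mult continuous_on_weight continuous_on_surplus) auto
  then show ?thesis using Rev_minus_eq[of _ 0] by simp
qed

text \<open>In the mixture formula the opaque price enters only through
  \<open>min (r i) \<rho>\<close>, so prices above \<open>c\<close> act like
  \<open>c\<close>.\<close>

lemma Rev_min:
  assumes c: "\<And>i. i \<in> S \<Longrightarrow> r i \<le> c"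
  shows "Rev M \<epsilon> k v r T S (min \<rho> c) = Rev M \<epsilon> k v r T S \<rho>"
proof -
  have mn: "min (r i) (min \<rho> c) = min (r i) \<rho>" if "i \<in> S" for i using c[OF that] by simp
  then have low: "low_shift v r (min \<rho> c) i = low_shift v r \<rho> i" if "i \<in> S" for i
    using that by (simp add: low_shift_def)
  have "factor (min \<rho> c) K j x = factor \<rho> K j x" if "j \<in> insert 0 S" "K \<subseteq> T" for K j x
  proof (cases "j = 0")
    case True
    then show ?thesis using that zero_notin_T by (auto simp: config_factor_def)
  qed (use that low in \<open>auto simp: config_factor_def\<close>)
  then have w: "weight (min \<rho> c) K = weight \<rho> K" if "K \<subseteq> T" for K
    unfolding config_weight_def using that by (simp only: cong: prod.cong)
  have s: "surplus v r S U (min \<rho> c) 0 = surplus v r S U \<rho> 0" for U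
    unfolding surplus_def by (intro arg_cong2[of _ _ _ _ "(-)"] sum.cong refl) (simp only: low mn)
  have "Rev M \<epsilon> k v r T S (min \<rho> c) - 0 = Rev M \<epsilon> k v r T S \<rho> - 0"
    unfolding Rev_minus_eq s using w by (intro sum.cong refl) simp
  then show ?thesis by simp
qed

lemma Rev_attains_max: "\<exists>p. is_max_value (\<lambda>\<rho>. Rev M \<epsilon> k v r T S \<rho>) {0..} p"
proof -
  \<comment> \<open>Inserting 0 keeps the maximum defined for empty \<open>S\<close> and the
    interval \<open>{0..c}\<close> nonempty.\<close>
  define c where "c = Max (insert 0 (r ` S))"
  have c: "0 \<le> c" "\<And>i. i \<in> S \<Longrightarrow> r i \<le> c" using finite_S by (auto simp: c_def)
  obtain \<rho>0 where \<rho>0: "\<rho>0 \<in> {0..c}" "\<And>\<rho>. \<rho> \<in> {0..c} \<Longrightarrow> Rev M \<epsilon> k v r T S \<rho> \<le> Rev M \<epsilon> k v r T S \<rho>0"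
    using continuous_attains_sup[OF compact_Icc _ continuous_on_Rev[of "{0..c}"]] c(1) by auto
  have "Rev M \<epsilon> k v r T S \<rho> \<le> Rev M \<epsilon> k v r T S \<rho>0" if "0 \<le> \<rho>" for \<rho>
    using \<rho>0(2)[of "min \<rho> c"] Rev_min[OF c(2), of \<rho>] that c(1) by simp
  then show ?thesis using \<rho>0(1) unfolding is_max_value_def by (intro exI bexI[of _ \<rho>0] conjI) auto
qed

end

section \<open>Exchange argument and the optimal initial segment\<close>

text \<open>Products with \<open>r i < R\<close> contribute negatively at either price, the others
  nonnegatively at full price.\<close>

lemma surplus_filter_le:
  fixes r :: "nat \<Rightarrow> real"
  assumes "finite N" "S \<subseteq> N" "U \<subseteq> S"
    and S1_def: "S1 = {i\<in>N. R \<le> r i}"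
  shows "surplus v r S U \<rho> R \<le> surplus v r S1 (U \<inter> S1) \<rho> R"
proof -
  let ?g = "\<lambda>U i. if i \<in> U then exp (low_shift v r \<rho> i) * (min (r i) \<rho> - R)
        else exp (base_shift v r i) * (r i - R)"
  have fin: "finite S" using assms finite_subset by blast
  have "(\<Sum>i\<in>S. ?g U i) \<le> (\<Sum>i\<in>S. if i \<in> S1 then ?g U i else 0)"
    using assms(2) by (intro sum_mono) (auto simp: S1_def intro!: mult_nonneg_nonpos)
  also have "\<dots> = (\<Sum>i\<in>{i\<in>S. i \<in> S1}. ?g U i)" using fin by (rule sum.inter_filter[symmetric])
  also have "\<dots> = (\<Sum>i\<in>{i\<in>S. i \<in> S1}. ?g (U \<inter> S1) i)" by (intro sum.cong) auto
  also have "\<dots> \<le> (\<Sum>i\<in>S1. ?g (U \<inter> S1) i)"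
  proof (rule sum_mono2)
    fix i assume i: "i \<in> S1 - {i\<in>S. i \<in> S1}"
    then have "i \<notin> U" using assms(3) by blast
    then show "0 \<le> ?g (U \<inter> S1) i" using i by (auto simp: S1_def)
  qed (use assms(1) in \<open>auto simp: S1_def\<close>)
  finally show ?thesis by (simp add: surplus_def)
qed

lemma is_max_value_Max:
  assumes "finite A" "A \<noteq> {}"
  shows "is_max_value f A (Max (f ` A))"
proof -
  have "Max (f ` A) \<in> f ` A" using assms by (intro Max_in) auto
  then obtain x where "x \<in> A" "Max (f ` A) = f x" by blast
  moreover have "\<forall>x\<in>A. f x \<le> Max (f ` A)" using assms(1) by (intro ballI Max_ge) auto
  ultimately show ?thesis unfolding is_max_value_def by metis
qed

theorem theorem2:
  fixes M :: "'a measure"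
    and \<epsilon> :: "nat \<Rightarrow> 'a \<Rightarrow> real"
    and n k :: nat
    and v r :: "nat \<Rightarrow> real"
  assumes "prob_space M"
    and "prob_space.indep_vars M (\<lambda>_. borel) \<epsilon> {0..n}"
    and "\<And>i. i \<in> {0..n} \<Longrightarrow> distributed M lborel (\<epsilon> i) std_gumbel_density"
    and "k \<in> {1..n}"
    and "\<And>i. i \<in> {1..n} \<Longrightarrow> 0 \<le> r i"
    and "antimono_on {1..n} r"
  shows "\<exists>j\<in>{1..n}. optimal_assortment M \<epsilon> n k v r {1..j}"
proof -
  have noise: "gumbel_noise M \<epsilon> n"
    using assms(1-3) by (simp add: gumbel_noise_def gumbel_noise_axioms_def)
  have offer: "opaque_offer M \<epsilon> n k S T" if "S \<subseteq> {1..n}" "T \<subseteq> S" for S T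
    using noise that assms(4) by (simp add: opaque_offer_def opaque_offer_axioms_def)
  let ?rev = "Rev M \<epsilon> k v r"
  define P where "P S T = (SOME p. is_max_value (\<lambda>\<rho>. ?rev T S \<rho>) {0..} p)" for S T
  have P: "is_max_value (\<lambda>\<rho>. ?rev T S \<rho>) {0..} (P S T)" if "S \<subseteq> {1..n}" "T \<subseteq> S" for S T
    unfolding P_def by (rule someI_ex[OF opaque_offer.Rev_attains_max[OF offer[OF that]]])
  define Q where "Q S = Max (P S ` Pow S)" for S
  have Q: "is_max_value (P S) (Pow S) (Q S)" if "S \<subseteq> {1..n}" for S
    unfolding Q_def using that by (intro is_max_value_Max) (auto intro: finite_subset)
  define R where "R = Max (Q ` Pow {1..n})"
  have R: "is_max_value Q (Pow {1..n}) R"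
    unfolding R_def by (rule is_max_value_Max) auto
  have le: "?rev T S \<rho> \<le> R" if "S \<subseteq> {1..n}" "T \<subseteq> S" "0 \<le> \<rho>" for S T \<rho>
  proof -
    have "?rev T S \<rho> \<le> P S T" using P[OF that(1,2)] that(3) by (simp add: is_max_value_def)
    also have "\<dots> \<le> Q S" using Q[OF that(1)] that(2) by (simp add: is_max_value_def)
    also have "\<dots> \<le> R" using R that(1) by (simp add: is_max_value_def)
    finally show ?thesis .
  qed
  \<comment> \<open>Unwinding the nested maxima yields an offer and a price that attain the overall
    optimum \<open>R\<close>.\<close>
  obtain S0 where S0: "S0 \<subseteq> {1..n}" "Q S0 = R" using R unfolding is_max_value_def by blast
  obtain T0 where T0: "T0 \<subseteq> S0" "P S0 T0 = R" using Q[OF S0(1)] S0(2) unfolding is_max_value_def by blast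
  obtain \<rho> where \<rho>: "0 \<le> \<rho>" "?rev T0 S0 \<rho> = R"
    using P[OF S0(1) T0(1)] T0(2) unfolding is_max_value_def by auto
  obtain U where U: "U \<subseteq> T0" "card U \<le> k" "0 \<le> surplus v r S0 U \<rho> R"
    using opaque_offer.exists_small_support[OF offer[OF S0(1) T0(1)], of R v r \<rho>] \<rho>(2) by auto
  \<comment> \<open>The threshold is the optimal value itself: products of \<open>S0\<close> cheaper
    than \<open>R\<close> are dropped, and all products priced at least \<open>R\<close> are
    offered.\<close>
  define S1 where "S1 = {i\<in>{1..n}. R \<le> r i}"
  have S1: "S1 \<subseteq> {1..n}" by (auto simp: S1_def)
  have pos: "0 \<le> surplus v r S1 (U \<inter> S1) \<rho> R"
    using surplus_filter_le[OF _ S0(1) order.trans[OF U(1) T0(1)] S1_def, of v \<rho>] U(3) by simp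
  have finU: "finite U" using U(1) T0(1) S0(1) by (meson finite_atLeastAtMost finite_subset)
  have "card (U \<inter> S1) \<le> k" using card_mono[OF finU, of "U \<inter> S1"] U(2) by simp
  \<comment> \<open>At most \<open>k\<close> products are discounted, so this MNL model is realised
    by an opaque offer and a nonnegative surplus becomes a revenue of at least
    \<open>R\<close>.\<close>
  then have "0 \<le> ?rev (U \<inter> S1) S1 \<rho> - R"
    using opaque_offer.Rev_minus_eq_small[OF offer[OF S1, of "U \<inter> S1"], of v r \<rho>] pos by simp
  then have "R \<le> ?rev (U \<inter> S1) S1 \<rho>" by simp
  also have "\<dots> \<le> P S1 (U \<inter> S1)" using P[OF S1, of "U \<inter> S1"] \<rho>(1) by (simp add: is_max_value_def)
  also have "\<dots> \<le> Q S1" using Q[OF S1] by (simp add: is_max_value_def)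
  finally have "Q S1 = R" using R S1 by (auto simp: is_max_value_def intro: antisym)
  then have opt: "optimal_assortment M \<epsilon> n k v r S1"
    unfolding optimal_assortment_def using S1 P Q R by (intro conjI exI[of _ P] exI[of _ Q]) auto
  have "S1 \<noteq> {}"
  proof
    assume S1e: "S1 = {}"
    \<comment> \<open>The surplus of the empty assortment is \<open>- R\<close>. Hence
      \<open>R \<le> 0 \<le> r 1\<close>, which would put product 1 into \<open>S1\<close>.\<close>
    then have "R \<le> 0" using pos by (simp add: surplus_def)
    moreover have "1 \<in> {1..n}" using assms(4) by auto
    ultimately show False using S1e assms(5)[of 1] by (force simp: S1_def)
  qed
  have fin: "finite S1" using S1 finite_subset by blast
  have "S1 = {1..Max S1}"
  proof
    show "S1 \<subseteq> {1..Max S1}" using S1 fin by auto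
    show "{1..Max S1} \<subseteq> S1"
    proof
      fix i assume i: "i \<in> {1..Max S1}"
      have M: "Max S1 \<in> S1" using fin \<open>S1 \<noteq> {}\<close> by simp
      then have "i \<in> {1..n}" "Max S1 \<in> {1..n}" using i S1 by auto
      \<comment> \<open>Prices do not increase with the index, so a product preceding a member of
        the threshold set also meets the threshold.\<close>
      then have "r (Max S1) \<le> r i" using assms(6) i by (auto simp: monotone_on_def)
      then show "i \<in> S1" using M \<open>i \<in> {1..n}\<close> by (auto simp: S1_def)
    qed
  qed
  moreover have "Max S1 \<in> {1..n}" using Max_in[OF fin \<open>S1 \<noteq> {}\<close>] S1 by blast
  ultimately show ?thesis using opt by metis
qed

end
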